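(* Assume the setting described in the context. Suppose that ENNAMCQ holds, i.e. $0\notin\nabla R(w)+N_C(w)$ for every $w\in C$ with $R(w)\ge0$, that $\zeta_k=o(\mu_k)$, and that there is $M_\gamma>1$ with $\widehat\gamma_t\le M_\gamma\widehat\gamma_{t+1}$ for all $t\ge0$. Let $\overline L=L$ under Strategy I and $\overline L=\max\{L_{\max},2L_{\rm safe}\}$ under Strategy II, and set $A_0:=M_f+c_2(\overline L+L_G)$, where $M_f=\max_{w\in C}\|\nabla f(w)\|$. (i) If $\{w\in C:R(w)\ge0\}=\varnothing$, then no penalty update occurs, and $\gamma_k=\underline\gamma:=\widehat\gamma_0$ for all $k\ge0$. (ii) If $\{w\in C:R(w)\ge0\}\ne\varnothing$, let $$\eta_\delta:=\min_{w\in C,\ R(w)\ge0}\operatorname{dist}\bigl(0,\nabla R(w)+N_C(w)\bigr)>0 .$$ Then there exists $k_0\ge0$ such that $$2\bigl[E_{\mu_k,\rho}(\zeta_k)+E_{\mu_k,\rho}(\zeta_{k+1})\bigr]+D_\rho(\zeta_{k+1})\le\frac{\eta_\delta}{2}\qquad\forall k\ge k_0,$$ and moreover $$\gamma_k\ge\underline\gamma:=\min\Bigl\{\widehat\gamma_{k_0},\ \frac{\eta_\delta}{4M_\gamma A_0}\Bigr\}>0\qquad\forall k\ge0 .$$ In either case, the penalty parameter is updated only finitely many times, and $\gamma_k$ is eventually constant.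
   Context: Problem setting. $X\subset\mathbb R^n$ and $Y\subset\mathbb R^m$ are nonempty, compact, convex; $C=X\times Y$ and $w=(x,y)$ denotes a point of $C$. The functions $f,g$ are real-valued, continuously differentiable on a neighborhood of $C$, and $\nabla f,\nabla g$ are $L_f$- resp. $L_g$-Lipschitz on $C$. $\sigma\ge0$ is such that $g(x,\cdot)+\frac\sigma2\|\cdot\|^2$ is convex on $Y$ for every $x\in X$. Fix $\rho>0$ with $\rho\sigma<1$ and $\delta>0$. Put $\psi_\rho(z;x,y)=g(x,z)+\frac1{2\rho}\|z-y\|^2$, $g_\rho(x,y)=\min_{z\in Y}\psi_\rho(z;x,y)$, with unique minimizer $z_\rho(x,y)$, and $R(w)=g(w)-g_\rho(w)-\delta$. $R$ is continuously differentiable on $C$ with $\nabla R(w)=\bigl(\nabla_xg(x,y)-\nabla_xg(x,z_\rho(w)),\ \nabla_yg(x,y)-\rho^{-1}(y-z_\rho(w))\bigr)$. $N_C$ is the normal cone, $P_C$ the Euclidean projection, $[t]_+=\max\{t,0\}$. Smoothing. For each $\mu>0$, $\phi_\mu:\mathbb R\to\mathbb R$ is convex, $C^1$, nondecreasing, and for constants $a_1,a_2,b_\phi,c_\phi\ge0$: $0\le\phi_\mu'\le1$; $[t]_+-a_1\mu\le\phi_\mu(t)\le[t]_++a_2\mu$; $|\phi_\mu'(t)-\phi_\mu'(s)|\le\frac{b_\phi}{\mu}|t-s|$; $\phi_{\mu_1}(t)\le\phi_{\mu_0}(t)+c_\phi(\mu_0-\mu_1)$ for $0<\mu_1\le\mu_0$.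 Set $a_\phi=a_1+a_2>0$. Constants. $m_\rho=\rho^{-1}-\sigma$; $L_{xy}>0$ is a Lipschitz constant of $y\mapsto\nabla_xg(x,y)$ on $Y$, uniform in $x\in X$; $L_R,B_R>0$ are a Lipschitz constant and a norm bound of $\nabla R$ on $C$; $L_{a,\rho}=\sqrt{L_{xy}^2+\rho^{-2}}$; $D_\rho(\zeta)=L_{a,\rho}\sqrt{2\zeta/m_\rho}$; $E_{\mu,\rho}(\zeta)=D_\rho(\zeta)+\frac{b_\phi B_R}{\mu}\zeta$; $L_G=b_\phi B_R^2+\mu_0L_R$. IVSP algorithm. Parameters: $c_1,c_2,\underline\vartheta>0$, $\hat\vartheta\in(0,2)$, $w^0\in C$, positive nonincreasing sequences $\mu_k\downarrow0$, $\zeta_k\downarrow0$, a strictly decreasing positive grid $\widehat\gamma_t\downarrow0$, $t_0=0$. A point $\widetilde z\in Y$ is $\zeta$-accurate at $w$ if $0\le\psi_\rho(\widetilde z;w)-g_\rho(w)\le\zeta$; it defines $\widetilde R(w)=g(w)-\psi_\rho(\widetilde z;w)-\delta$ and $\widetilde\nabla R(w)$, obtained from the formula for $\nabla R(w)$ by replacing $z_\rho(w)$ with $\widetilde z$. Start with a $\zeta_0$-accurate point $\widetilde z^0$ at $w^0$. At iteration $k$, with the current $\zeta_k$-accurate point $\widetilde z^k$ at $w^k$ and the associated $\widetilde R^k$, set $\gamma_k=\widehat\gamma_{t_k}$, $\widetilde\nabla G^k=\phi_{\mu_k}'(\widetilde R^k)\widetilde\nabla R(w^k)$ and, for $L>0$,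 $w_L^k=P_C\bigl(w^k-\frac{\mu_k}{L}[\gamma_k\nabla f(w^k)+\widetilde\nabla G^k]\bigr)$; compute a $\zeta_{k+1}$-accurate point $\widetilde z^+_{k,L}$ at $w_L^k$ with associated residual $\widetilde R^+_{k,L}$. Let $E_k^0=E_{\mu_k,\rho}(\zeta_k)$, $\vartheta_{k,L}=\max\{\min\{\mu_kE_k^0/\|w_L^k-w^k\|,\hat\vartheta L\},\underline\vartheta\}$ (the ratio is $+\infty$ if $w_L^k=w^k$), $\tau_{k,L}=\frac{\mu_k}{2\vartheta_{k,L}}(E_k^0)^2+\zeta_k+\zeta_{k+1}$. Choice of $L_k$: Strategy I uses a fixed $L_k=L\ge L_{\rm safe}:=\max\{\underline\vartheta/\hat\vartheta,\ (c_1+\widehat\gamma_0\mu_0L_f+L_G)/(2-\hat\vartheta)\}$. Strategy II starts from some $L_{k,0}\in[L_{\min},L_{\max}]$ ($0<L_{\min}\le L_{\max}<\infty$) and doubles $L$ until $$\gamma_kf(w_L^k)+\phi_{\mu_k}(\widetilde R^+_{k,L}+\zeta_{k+1})\le\gamma_kf(w^k)+\phi_{\mu_k}(\widetilde R^k)-\tfrac{c_1}{2\mu_k}\|w_L^k-w^k\|^2+\tau_{k,L};$$ $L_k$ is the accepted $L$. Set $w^{k+1}=w^k_{L_k}$, $\widetilde z^{k+1}=\widetilde z^+_{k,L_k}$, $\widetilde R^{k+1}=\widetilde R^+_{k,L_k}$. Penalty update: if $\widetilde R^{k+1}>2a_\phi\mu_k$ and $\|w^{k+1}-w^k\|\le c_2\mu_k\gamma_k$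 then $t_{k+1}=t_k+1$ (a penalty update occurs at iteration $k$), otherwise $t_{k+1}=t_k$. *)

theory Defs
  imports "HOL-Analysis.Analysis" "HOL-Library.Landau_Symbols"
begin

definition grad :: "('a::real_inner \<Rightarrow> real) \<Rightarrow> 'a \<Rightarrow> 'a" where
  "grad h x = (THE D. GDERIV h x :> D)"

definition C1_near :: "('a::real_inner \<Rightarrow> real) \<Rightarrow> 'a set \<Rightarrow> bool" where
  "C1_near h S \<longleftrightarrow>
    (\<exists>U. open U \<and> S \<subseteq> U \<and> (\<forall>x\<in>U. h differentiable (at x)) \<and> continuous_on U (grad h))"

definition grad_x :: "('a::real_inner \<times> 'b::real_inner \<Rightarrow> real) \<Rightarrow> 'a \<Rightarrow> 'b \<Rightarrow> 'a" where
  "grad_x h x y = grad (\<lambda>u. h (u, y)) x"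

definition grad_y :: "('a::real_inner \<times> 'b::real_inner \<Rightarrow> real) \<Rightarrow> 'a \<Rightarrow> 'b \<Rightarrow> 'b" where
  "grad_y h x y = grad (\<lambda>v. h (x, v)) y"

definition normal_cone :: "'a::real_inner set \<Rightarrow> 'a \<Rightarrow> 'a set" where
  "normal_cone S w = {v. w \<in> S \<and> (\<forall>u\<in>S. v \<bullet> (u - w) \<le> 0)}"

(* Fixed L, resp. Backtracking Lmin Lmax: the two rules for choosing L_k. *)
datatype strategy = Fixed real | Backtracking real real

(* All data that are fixed before the algorithm is run. The fields sm_a1 ... sm_c are the constants
   of the smoothing family; th_lo and th_hi are the bounds on the parameter vartheta; mu, zeta and
   grid are the sequences mu_k, zeta_k and the penalty grid. *)
record ('n::finite, 'm::finite) ivsp =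
  dom_x :: "(real ^ 'n) set"
  dom_y :: "(real ^ 'm) set"
  fun_f :: "(real ^ 'n) \<times> (real ^ 'm) \<Rightarrow> real"
  fun_g :: "(real ^ 'n) \<times> (real ^ 'm) \<Rightarrow> real"
  lip_f :: real
  lip_g :: real
  sigma :: real
  rho :: real
  delta :: real
  phi :: "real \<Rightarrow> real \<Rightarrow> real"
  sm_a1 :: real
  sm_a2 :: real
  sm_b :: real
  sm_c :: real
  lip_xy :: real
  lip_R :: real
  bnd_R :: real
  par_c1 :: real
  par_c2 :: real
  th_lo :: real
  th_hi :: real
  mu :: "nat \<Rightarrow> real"
  zeta :: "nat \<Rightarrow> real"
  grid :: "nat \<Rightarrow> real"
  strat :: strategy

(* The quantities produced by a run. it_L0 is the initial L_{k,0} of the line search, and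
   it_zplus k L is the inexact lower-level point computed at the trial point w^k_L. *)
record ('n::finite, 'm::finite) trace =
  it_w :: "nat \<Rightarrow> (real ^ 'n) \<times> (real ^ 'm)"
  it_z :: "nat \<Rightarrow> real ^ 'm"
  it_t :: "nat \<Rightarrow> nat"
  it_L :: "nat \<Rightarrow> real"
  it_L0 :: "nat \<Rightarrow> real"
  it_zplus :: "nat \<Rightarrow> real \<Rightarrow> real ^ 'm"

definition feas :: "('n::finite, 'm::finite) ivsp \<Rightarrow> ((real ^ 'n) \<times> (real ^ 'm)) set" where
  "feas P = dom_x P \<times> dom_y P"

definition psi :: "('n::finite, 'm::finite) ivsp \<Rightarrow> real ^ 'm \<Rightarrow> (real ^ 'n) \<times> (real ^ 'm) \<Rightarrow> real" where
  "psi P z w = fun_g P (fst w, z) + 1 / (2 * rho P) * (norm (z - snd w))\<^sup>2"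

definition g_rho :: "('n::finite, 'm::finite) ivsp \<Rightarrow> (real ^ 'n) \<times> (real ^ 'm) \<Rightarrow> real" where
  "g_rho P w = (INF z\<in>dom_y P. psi P z w)"

definition z_rho :: "('n::finite, 'm::finite) ivsp \<Rightarrow> (real ^ 'n) \<times> (real ^ 'm) \<Rightarrow> real ^ 'm" where
  "z_rho P w = (THE z. z \<in> dom_y P \<and> (\<forall>z'\<in>dom_y P. psi P z w \<le> psi P z' w))"

definition R_val :: "('n::finite, 'm::finite) ivsp \<Rightarrow> (real ^ 'n) \<times> (real ^ 'm) \<Rightarrow> real" where
  "R_val P w = fun_g P w - g_rho P w - delta P"

definition R_inexact ::
  "('n::finite, 'm::finite) ivsp \<Rightarrow> real ^ 'm \<Rightarrow> (real ^ 'n) \<times> (real ^ 'm) \<Rightarrow> real" where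
  "R_inexact P z w = fun_g P w - psi P z w - delta P"

definition gradR_inexact ::
  "('n::finite, 'm::finite) ivsp \<Rightarrow> real ^ 'm \<Rightarrow> (real ^ 'n) \<times> (real ^ 'm) \<Rightarrow> (real ^ 'n) \<times> (real ^ 'm)" where
  "gradR_inexact P z w =
    (grad_x (fun_g P) (fst w) (snd w) - grad_x (fun_g P) (fst w) z,
     grad_y (fun_g P) (fst w) (snd w) - (1 / rho P) *\<^sub>R (snd w - z))"

(* The gradient of R_val on feas P, given by Danskin's formula. It cannot be defined as
   grad (R_val P): off feas P the function g_rho need not be differentiable, and feas P may have
   empty interior. *)
definition gradR :: "('n::finite, 'm::finite) ivsp \<Rightarrow> (real ^ 'n) \<times> (real ^ 'm) \<Rightarrow> (real ^ 'n) \<times> (real ^ 'm)" where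
  "gradR P w = gradR_inexact P (z_rho P w) w"

definition bilevel_setting :: "('n::finite, 'm::finite) ivsp \<Rightarrow> bool" where
  "bilevel_setting P \<longleftrightarrow>
     dom_x P \<noteq> {} \<and> compact (dom_x P) \<and> convex (dom_x P) \<and>
     dom_y P \<noteq> {} \<and> compact (dom_y P) \<and> convex (dom_y P) \<and>
     C1_near (fun_f P) (feas P) \<and> C1_near (fun_g P) (feas P) \<and>
     (lip_f P)-lipschitz_on (feas P) (grad (fun_f P)) \<and>
     (lip_g P)-lipschitz_on (feas P) (grad (fun_g P)) \<and>
     0 \<le> sigma P \<and>
     (\<forall>x\<in>dom_x P. convex_on (dom_y P) (\<lambda>y. fun_g P (x, y) + sigma P / 2 * (norm y)\<^sup>2)) \<and>
     0 < rho P \<and> rho P * sigma P < 1 \<and> 0 < delta P \<and>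
     0 < lip_xy P \<and> (\<forall>x\<in>dom_x P. (lip_xy P)-lipschitz_on (dom_y P) (\<lambda>y. grad_x (fun_g P) x y)) \<and>
     0 < lip_R P \<and> (lip_R P)-lipschitz_on (feas P) (gradR P) \<and>
     0 < bnd_R P \<and> (\<forall>w\<in>feas P. norm (gradR P w) \<le> bnd_R P)"

definition a_phi :: "('n::finite, 'm::finite) ivsp \<Rightarrow> real" where
  "a_phi P = sm_a1 P + sm_a2 P"

definition smoothing_family :: "('n::finite, 'm::finite) ivsp \<Rightarrow> bool" where
  "smoothing_family P \<longleftrightarrow>
     0 \<le> sm_a1 P \<and> 0 \<le> sm_a2 P \<and> 0 \<le> sm_b P \<and> 0 \<le> sm_c P \<and> 0 < a_phi P \<and>
     (\<forall>\<nu>>0.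
        convex_on UNIV (phi P \<nu>) \<and>
        (\<forall>s. phi P \<nu> differentiable (at s)) \<and> continuous_on UNIV (deriv (phi P \<nu>)) \<and>
        mono (phi P \<nu>) \<and>
        (\<forall>s. 0 \<le> deriv (phi P \<nu>) s \<and> deriv (phi P \<nu>) s \<le> 1) \<and>
        (\<forall>s. max s 0 - sm_a1 P * \<nu> \<le> phi P \<nu> s \<and> phi P \<nu> s \<le> max s 0 + sm_a2 P * \<nu>) \<and>
        (\<forall>s r. \<bar>deriv (phi P \<nu>) s - deriv (phi P \<nu>) r\<bar> \<le> sm_b P / \<nu> * \<bar>s - r\<bar>)) \<and>
     (\<forall>\<nu> \<nu>' s. 0 < \<nu> \<and> \<nu> \<le> \<nu>' \<longrightarrow> phi P \<nu> s \<le> phi P \<nu>' s + sm_c P * (\<nu>' - \<nu>))"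

definition m_rho :: "('n::finite, 'm::finite) ivsp \<Rightarrow> real" where
  "m_rho P = 1 / rho P - sigma P"

definition L_a :: "('n::finite, 'm::finite) ivsp \<Rightarrow> real" where
  "L_a P = sqrt ((lip_xy P)\<^sup>2 + (1 / rho P)\<^sup>2)"

definition D_rho :: "('n::finite, 'm::finite) ivsp \<Rightarrow> real \<Rightarrow> real" where
  "D_rho P e = L_a P * sqrt (2 * e / m_rho P)"

definition E_rho :: "('n::finite, 'm::finite) ivsp \<Rightarrow> real \<Rightarrow> real \<Rightarrow> real" where
  "E_rho P \<nu> e = D_rho P e + sm_b P * bnd_R P / \<nu> * e"

definition L_G :: "('n::finite, 'm::finite) ivsp \<Rightarrow> real" where
  "L_G P = sm_b P * (bnd_R P)\<^sup>2 + mu P 0 * lip_R P"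

definition L_safe :: "('n::finite, 'm::finite) ivsp \<Rightarrow> real" where
  "L_safe P = max (th_lo P / th_hi P)
     ((par_c1 P + grid P 0 * mu P 0 * lip_f P + L_G P) / (2 - th_hi P))"

definition ivsp_parameters :: "('n::finite, 'm::finite) ivsp \<Rightarrow> bool" where
  "ivsp_parameters P \<longleftrightarrow>
     0 < par_c1 P \<and> 0 < par_c2 P \<and> 0 < th_lo P \<and> 0 < th_hi P \<and> th_hi P < 2 \<and>
     (\<forall>k. 0 < mu P k) \<and> decseq (mu P) \<and> mu P \<longlonglongrightarrow> 0 \<and>
     (\<forall>k. 0 < zeta P k) \<and> decseq (zeta P) \<and> zeta P \<longlonglongrightarrow> 0 \<and>
     (\<forall>t. 0 < grid P t) \<and> (\<forall>t. grid P (Suc t) < grid P t) \<and> grid P \<longlonglongrightarrow> 0 \<and>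
     (case strat P of
        Fixed L \<Rightarrow> L_safe P \<le> L
      | Backtracking Lmin Lmax \<Rightarrow> 0 < Lmin \<and> Lmin \<le> Lmax)"

definition accurate ::
  "('n::finite, 'm::finite) ivsp \<Rightarrow> real \<Rightarrow> real ^ 'm \<Rightarrow> (real ^ 'n) \<times> (real ^ 'm) \<Rightarrow> bool" where
  "accurate P e z w \<longleftrightarrow> z \<in> dom_y P \<and> 0 \<le> psi P z w - g_rho P w \<and> psi P z w - g_rho P w \<le> e"

definition gam :: "('n::finite, 'm::finite) ivsp \<Rightarrow> ('n, 'm) trace \<Rightarrow> nat \<Rightarrow> real" where
  "gam P S k = grid P (it_t S k)"

definition R_it :: "('n::finite, 'm::finite) ivsp \<Rightarrow> ('n, 'm) trace \<Rightarrow> nat \<Rightarrow> real" where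
  "R_it P S k = R_inexact P (it_z S k) (it_w S k)"

definition gradG_it ::
  "('n::finite, 'm::finite) ivsp \<Rightarrow> ('n, 'm) trace \<Rightarrow> nat \<Rightarrow> (real ^ 'n) \<times> (real ^ 'm)" where
  "gradG_it P S k = deriv (phi P (mu P k)) (R_it P S k) *\<^sub>R gradR_inexact P (it_z S k) (it_w S k)"

definition trial ::
  "('n::finite, 'm::finite) ivsp \<Rightarrow> ('n, 'm) trace \<Rightarrow> nat \<Rightarrow> real \<Rightarrow> (real ^ 'n) \<times> (real ^ 'm)" where
  "trial P S k L = closest_point (feas P)
     (it_w S k - (mu P k / L) *\<^sub>R (gam P S k *\<^sub>R grad (fun_f P) (it_w S k) + gradG_it P S k))"

definition R_plus :: "('n::finite, 'm::finite) ivsp \<Rightarrow> ('n, 'm) trace \<Rightarrow> nat \<Rightarrow> real \<Rightarrow> real" where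
  "R_plus P S k L = R_inexact P (it_zplus S k L) (trial P S k L)"

definition E0 :: "('n::finite, 'm::finite) ivsp \<Rightarrow> nat \<Rightarrow> real" where
  "E0 P k = E_rho P (mu P k) (zeta P k)"

(* In the first branch the ratio mu_k * E0 / 0 stands for plus infinity. *)
definition vartheta :: "('n::finite, 'm::finite) ivsp \<Rightarrow> ('n, 'm) trace \<Rightarrow> nat \<Rightarrow> real \<Rightarrow> real" where
  "vartheta P S k L = max
     (if trial P S k L = it_w S k then th_hi P * L
      else min (mu P k * E0 P k / norm (trial P S k L - it_w S k)) (th_hi P * L))
     (th_lo P)"

definition tau :: "('n::finite, 'm::finite) ivsp \<Rightarrow> ('n, 'm) trace \<Rightarrow> nat \<Rightarrow> real \<Rightarrow> real" where
  "tau P S k L =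
     mu P k / (2 * vartheta P S k L) * (E0 P k)\<^sup>2 + zeta P k + zeta P (Suc k)"

definition accepted :: "('n::finite, 'm::finite) ivsp \<Rightarrow> ('n, 'm) trace \<Rightarrow> nat \<Rightarrow> real \<Rightarrow> bool" where
  "accepted P S k L \<longleftrightarrow>
     gam P S k * fun_f P (trial P S k L) + phi P (mu P k) (R_plus P S k L + zeta P (Suc k))
     \<le> gam P S k * fun_f P (it_w S k) + phi P (mu P k) (R_it P S k)
        - par_c1 P / (2 * mu P k) * (norm (trial P S k L - it_w S k))\<^sup>2 + tau P S k L"

(* The lower-level points need to be accurate only at the values of L that are actually tried. *)
definition L_choice :: "('n::finite, 'm::finite) ivsp \<Rightarrow> ('n, 'm) trace \<Rightarrow> nat \<Rightarrow> bool" where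
  "L_choice P S k \<longleftrightarrow>
     (case strat P of
        Fixed L \<Rightarrow>
          it_L S k = L \<and> accurate P (zeta P (Suc k)) (it_zplus S k L) (trial P S k L)
      | Backtracking Lmin Lmax \<Rightarrow>
          Lmin \<le> it_L0 S k \<and> it_L0 S k \<le> Lmax \<and>
          (\<exists>j. it_L S k = 2 ^ j * it_L0 S k \<and>
             (\<forall>i\<le>j. accurate P (zeta P (Suc k))
                (it_zplus S k (2 ^ i * it_L0 S k)) (trial P S k (2 ^ i * it_L0 S k))) \<and>
             (\<forall>i<j. \<not> accepted P S k (2 ^ i * it_L0 S k)) \<and>
             accepted P S k (2 ^ j * it_L0 S k)))"

definition penalty_update :: "('n::finite, 'm::finite) ivsp \<Rightarrow> ('n, 'm) trace \<Rightarrow> nat \<Rightarrow> bool" where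
  "penalty_update P S k \<longleftrightarrow>
     R_it P S (Suc k) > 2 * a_phi P * mu P k \<and>
     norm (it_w S (Suc k) - it_w S k) \<le> par_c2 P * mu P k * gam P S k"

definition ivsp_run :: "('n::finite, 'm::finite) ivsp \<Rightarrow> ('n, 'm) trace \<Rightarrow> bool" where
  "ivsp_run P S \<longleftrightarrow>
     it_w S 0 \<in> feas P \<and> accurate P (zeta P 0) (it_z S 0) (it_w S 0) \<and> it_t S 0 = 0 \<and>
     (\<forall>k. L_choice P S k \<and>
          it_w S (Suc k) = trial P S k (it_L S k) \<and>
          it_z S (Suc k) = it_zplus S k (it_L S k) \<and>
          it_t S (Suc k) = (if penalty_update P S k then it_t S k + 1 else it_t S k))"

definition R_nonneg :: "('n::finite, 'm::finite) ivsp \<Rightarrow> ((real ^ 'n) \<times> (real ^ 'm)) set" where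
  "R_nonneg P = {w \<in> feas P. R_val P w \<ge> 0}"

definition gradR_cone ::
  "('n::finite, 'm::finite) ivsp \<Rightarrow> (real ^ 'n) \<times> (real ^ 'm) \<Rightarrow> ((real ^ 'n) \<times> (real ^ 'm)) set" where
  "gradR_cone P w = {gradR P w + v |v. v \<in> normal_cone (feas P) w}"

definition ENNAMCQ :: "('n::finite, 'm::finite) ivsp \<Rightarrow> bool" where
  "ENNAMCQ P \<longleftrightarrow> (\<forall>w\<in>feas P. R_val P w \<ge> 0 \<longrightarrow> 0 \<notin> gradR_cone P w)"

definition eta :: "('n::finite, 'm::finite) ivsp \<Rightarrow> real" where
  "eta P = (INF w\<in>R_nonneg P. infdist 0 (gradR_cone P w))"

definition M_f :: "('n::finite, 'm::finite) ivsp \<Rightarrow> real" where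
  "M_f P = (SUP w\<in>feas P. norm (grad (fun_f P) w))"

definition L_bar :: "('n::finite, 'm::finite) ivsp \<Rightarrow> real" where
  "L_bar P = (case strat P of Fixed L \<Rightarrow> L | Backtracking Lmin Lmax \<Rightarrow> max Lmax (2 * L_safe P))"

definition A0 :: "('n::finite, 'm::finite) ivsp \<Rightarrow> real" where
  "A0 P = M_f P + par_c2 P * (L_bar P + L_G P)"

end

theory Submission
  imports Defs
begin

text \<open>At a penalty update the inexact residual at the new iterate exceeds twice the smoothing error, so
  the smoothed penalty has slope in (1/2, 1] there, while accuracy of the lower-level point makes the
  exact residual nonnegative. The projection step is an optimality condition, which places a multiple
  of the gradient of R plus a normal vector within gamma_k M_f + (L_k + L_G) |w^{k+1} - w^k| / mu_k of
  zero, up to the gradient errors; the step test bounds this by gamma_k A_0 and the constraint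
  qualification bounds it from below by eta / 2. Hence updates stop once gamma_k is below eta / (4 A_0).
  The bound L_k \<le> L_bar under backtracking rests on a descent lemma for the smoothed penalty, for which
  the value function g_rho has to be differentiated along C (Danskin).\<close>

section \<open>Gradients on convex sets and normal cones\<close>

text \<open>The obstacle is that C may have empty interior while \<open>gradR\<close> is given only
  by a formula. So the derivatives of \<open>psi\<close>, \<open>g_rho\<close> and
  \<open>R_val\<close> are taken within C, and the estimates run along segments of this convex set.
  The value function is differentiated without limits of minimizers: freezing the minimizer that
  belongs to either end of a segment bounds the increment from both sides up to a quadratic term.
  The gradient error of an inexact lower-level point comes from strong convexity with modulus
  \<open>m_rho\<close>, which turns accuracy in value into distance to the minimizer; hence the
  square root in \<open>D_rho\<close>. The 4 in the threshold is 2 * 2: the slope bound 1/2 halves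
  eta, and from k0 on the gradient errors take at most half of what is left. The first k0 iterations
  raise the grid index by at most k0, which accounts for \<open>grid P k0\<close>, and
  \<open>M_gamma\<close> pays for the one grid step made by an update.\<close>

lemma grad_eqI:
  assumes "(h has_derivative (\<lambda>d. D \<bullet> d)) (at x)"
  shows "grad h x = D"
  unfolding grad_def gderiv_def
proof (rule the_equality)
  show "(h has_derivative (\<lambda>d. d \<bullet> D)) (at x)"
    using assms by (simp add: inner_commute)
  fix D' assume "(h has_derivative (\<lambda>d. d \<bullet> D')) (at x)"
  then have "(\<lambda>d. d \<bullet> D') = (\<lambda>d. D \<bullet> d)"
    using assms has_derivative_unique by blast
  then have "\<And>d. d \<bullet> D' = d \<bullet> D"
    by (simp add: fun_eq_iff inner_commute)
  then show "D' = D"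
    using vector_eq_ldot[of D' D] by blast
qed

text \<open>Riesz representation in finite dimension: the derivative is the inner product with its
  adjoint at 1, so differentiability alone gives the description \<open>grad\<close> its
  meaning.\<close>

lemma has_derivative_grad:
  fixes h :: "'a::euclidean_space \<Rightarrow> real"
  assumes "h differentiable (at x)"
  shows "(h has_derivative (\<lambda>d. grad h x \<bullet> d)) (at x)"
proof -
  obtain h' where h': "(h has_derivative h') (at x)"
    using assms by (auto simp: differentiable_def)
  then have lin: "linear h'"
    by (rule has_derivative_linear)
  have "h' d = adjoint h' 1 \<bullet> d" for d
    using adjoint_works[OF lin, of d 1] by (simp add: inner_commute[of d])
  then have "h' = (\<lambda>d. adjoint h' 1 \<bullet> d)"
    by blast
  then have "(h has_derivative (\<lambda>d. adjoint h' 1 \<bullet> d)) (at x)"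
    using h' by metis
  with grad_eqI[OF this] show ?thesis
    by simp
qed

lemma grad_x_eq:
  fixes h :: "'a::euclidean_space \<times> 'b::euclidean_space \<Rightarrow> real"
  assumes "h differentiable (at (x, y))"
  shows "grad_x h x y = fst (grad h (x, y))"
  unfolding grad_x_def
proof (rule grad_eqI)
  have "((\<lambda>u. h (u, y)) has_derivative (\<lambda>d. grad h (x, y) \<bullet> (d, 0))) (at x)"
    by (rule has_derivative_compose[of "\<lambda>u. (u, y)", OF _ has_derivative_grad[OF assms]])
      (auto intro!: derivative_eq_intros)
  then show "((\<lambda>u. h (u, y)) has_derivative (\<lambda>d. fst (grad h (x, y)) \<bullet> d)) (at x)"
    by (simp add: inner_prod_def)
qed

lemma grad_y_eq:
  fixes h :: "'a::euclidean_space \<times> 'b::euclidean_space \<Rightarrow> real"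
  assumes "h differentiable (at (x, y))"
  shows "grad_y h x y = snd (grad h (x, y))"
  unfolding grad_y_def
proof (rule grad_eqI)
  have "((\<lambda>u. h (x, u)) has_derivative (\<lambda>d. grad h (x, y) \<bullet> (0, d))) (at y)"
    by (rule has_derivative_compose[of "\<lambda>u. (x, u)", OF _ has_derivative_grad[OF assms]])
      (auto intro!: derivative_eq_intros)
  then show "((\<lambda>u. h (x, u)) has_derivative (\<lambda>d. snd (grad h (x, y)) \<bullet> d)) (at y)"
    by (simp add: inner_prod_def)
qed

section \<open>Quadratic estimates on convex sets\<close>

lemma lipschitz_gradient_upper:
  fixes h :: "'a::real_inner \<Rightarrow> real"
  assumes S: "convex S" and x: "x \<in> S" and y: "y \<in> S"
    and der: "\<And>w. w \<in> S \<Longrightarrow> (h has_derivative (\<lambda>d. D w \<bullet> d)) (at w within S)"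
    and lip: "L-lipschitz_on S D"
  shows "h y \<le> h x + D x \<bullet> (y - x) + L / 2 * (norm (y - x))\<^sup>2"
proof -
  define p where "p t = x + t *\<^sub>R (y - x)" for t :: real
  \<comment> \<open>Gap of the claimed bound along the segment. The Lipschitz condition makes its
    derivative nonpositive, so the mean value theorem yields \<open>q 1 \<le> q 0\<close>, which is
    the claim.\<close>
  define q where "q t = h (p t) - t * (D x \<bullet> (y - x)) - L / 2 * t\<^sup>2 * (norm (y - x))\<^sup>2" for t
  have pS: "p t \<in> S" if "t \<in> {0..1}" for t
    using convexD_alt[OF S x y, of t] that by (simp add: p_def algebra_simps)
  have hp: "((\<lambda>t. h (p t)) has_derivative (\<lambda>s. D (p t) \<bullet> (s *\<^sub>R (y - x)))) (at t within {0..1})"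
    if "t \<in> {0..1}" for t
  proof (rule has_derivative_in_compose2[OF der, where f = p])
    show "(p has_derivative (\<lambda>s. s *\<^sub>R (y - x))) (at t within {0..1})"
      unfolding p_def by (auto intro!: derivative_eq_intros)
  qed (use pS that in auto)
  have "(q has_derivative (\<lambda>s. D (p t) \<bullet> (s *\<^sub>R (y - x)) - s * (D x \<bullet> (y - x))
            - L / 2 * (2 * t * s) * (norm (y - x))\<^sup>2)) (at t within {0..1})"
    if "t \<in> {0..1}" for t
    unfolding q_def
  proof (intro has_derivative_diff hp[OF that])
    show "((\<lambda>t. t * (D x \<bullet> (y - x))) has_derivative (\<lambda>s. s * (D x \<bullet> (y - x)))) (at t within {0..1})"
      by (auto intro!: derivative_eq_intros)
    show "((\<lambda>t. L / 2 * t\<^sup>2 * (norm (y - x))\<^sup>2) has_derivative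
        (\<lambda>s. L / 2 * (2 * t * s) * (norm (y - x))\<^sup>2)) (at t within {0..1})"
      by (auto intro!: derivative_eq_intros)
  qed
  from mvt_simple[of 0 1 q, OF _ this] obtain t where t: "t \<in> {0<..<1}"
    and q: "q 1 - q 0 = D (p t) \<bullet> (y - x) - D x \<bullet> (y - x) - L * t * (norm (y - x))\<^sup>2"
    by auto
  have "D (p t) \<bullet> (y - x) - D x \<bullet> (y - x) \<le> norm (D (p t) - D x) * norm (y - x)"
    by (metis inner_diff_left norm_cauchy_schwarz)
  also have "\<dots> \<le> (L * norm (p t - x)) * norm (y - x)"
    using lipschitz_onD[OF lip, of "p t" x] pS[of t] t x
    by (intro mult_right_mono) (auto simp: dist_norm)
  also have "\<dots> = L * t * (norm (y - x))\<^sup>2"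
    using t by (simp add: p_def power2_eq_square)
  finally have "q 1 \<le> q 0"
    using q by linarith
  moreover have "q 1 = h y - D x \<bullet> (y - x) - L / 2 * (norm (y - x))\<^sup>2"
    unfolding q_def p_def by simp
  moreover have "q 0 = h x"
    unfolding q_def p_def by simp
  ultimately show ?thesis
    by linarith
qed

lemma lipschitz_gradient_bound:
  fixes h :: "'a::real_inner \<Rightarrow> real"
  assumes S: "convex S" and x: "x \<in> S" and y: "y \<in> S"
    and der: "\<And>w. w \<in> S \<Longrightarrow> (h has_derivative (\<lambda>d. D w \<bullet> d)) (at w within S)"
    and lip: "L-lipschitz_on S D"
  shows "\<bar>h y - h x - D x \<bullet> (y - x)\<bar> \<le> L / 2 * (norm (y - x))\<^sup>2"
proof -
  have "((\<lambda>w. - h w) has_derivative (\<lambda>d. (- D w) \<bullet> d)) (at w within S)" if "w \<in> S" for w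
    using has_derivative_minus[OF der[OF that]] by simp
  moreover have "L-lipschitz_on S (\<lambda>w. - D w)"
    using lip by (simp add: lipschitz_on_minus)
  ultimately have "- h y \<le> - h x + (- D x) \<bullet> (y - x) + L / 2 * (norm (y - x))\<^sup>2"
    by (rule lipschitz_gradient_upper[OF S x y])
  then show ?thesis
    using lipschitz_gradient_upper[OF S x y der lip] unfolding abs_le_iff inner_minus_left
    by linarith
qed

text \<open>A quadratic remainder is of smaller order than the increment. In this form Danskin's
  theorem reduces to a two-sided inequality.\<close>

lemma has_derivative_of_quadratic_error:
  fixes h :: "'a::real_inner \<Rightarrow> real"
  assumes "\<And>y. y \<in> S \<Longrightarrow> \<bar>h y - h x - D \<bullet> (y - x)\<bar> \<le> K * (norm (y - x))\<^sup>2"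
  shows "(h has_derivative (\<lambda>d. D \<bullet> d)) (at x within S)"
  unfolding has_derivative_within_alt
proof (intro conjI allI impI)
  show "bounded_linear ((\<bullet>) D)"
    by (rule bounded_linear_inner_right)
  fix e :: real assume e: "0 < e"
  \<comment> \<open>The radius uses \<open>\<bar>K\<bar> + 1\<close> because the sign of K is
    unrestricted and K may vanish.\<close>
  show "\<exists>d>0. \<forall>y\<in>S. norm (y - x) < d \<longrightarrow> norm (h y - h x - D \<bullet> (y - x)) \<le> e * norm (y - x)"
  proof (intro exI[of _ "e / (\<bar>K\<bar> + 1)"] conjI ballI impI)
    show "0 < e / (\<bar>K\<bar> + 1)"
      using e by simp
    fix y assume y: "y \<in> S" and n: "norm (y - x) < e / (\<bar>K\<bar> + 1)"
    have "\<bar>h y - h x - D \<bullet> (y - x)\<bar> \<le> K * (norm (y - x))\<^sup>2"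
      by (rule assms[OF y])
    also have "\<dots> \<le> (\<bar>K\<bar> + 1) * (norm (y - x))\<^sup>2"
      by (intro mult_right_mono) auto
    also have "\<dots> = ((\<bar>K\<bar> + 1) * norm (y - x)) * norm (y - x)"
      by (simp add: power2_eq_square)
    also have "\<dots> \<le> e * norm (y - x)"
      using n by (intro mult_right_mono) (auto simp: field_simps)
    finally show "norm (h y - h x - D \<bullet> (y - x)) \<le> e * norm (y - x)"
      by simp
  qed
qed

text \<open>Compare the minimizer with the point at parameter t on the segment to z. Dividing by t
  leaves the factor 1 - t, which disappears as t tends to 0.\<close>

lemma minimizer_quadratic_growth:
  fixes h :: "'a::real_inner \<Rightarrow> real"
  assumes S: "convex S" and conv: "convex_on S (\<lambda>z. h z - m / 2 * (norm z)\<^sup>2)"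
    and a: "a \<in> S" and min: "\<And>z. z \<in> S \<Longrightarrow> h a \<le> h z" and z: "z \<in> S"
  shows "m / 2 * (norm (z - a))\<^sup>2 \<le> h z - h a"
proof -
  have step: "(1 - t) * (m / 2 * (norm (z - a))\<^sup>2) \<le> h z - h a" if t: "0 < t" "t < 1" for t
  proof -
    define u where "u = (1 - t) *\<^sub>R a + t *\<^sub>R z"
    have "u \<in> S"
      unfolding u_def using S a z t by (intro convexD_alt) auto
    then have "h a \<le> h u"
      by (rule min)
    moreover have "h u - m / 2 * (norm u)\<^sup>2
        \<le> (1 - t) * (h a - m / 2 * (norm a)\<^sup>2) + t * (h z - m / 2 * (norm z)\<^sup>2)"
      unfolding u_def using convex_onD[OF conv, of t a z] a z t by simp
    \<comment> \<open>This is an exact identity, so convexity of the shifted function becomes strong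
      convexity of h with nothing lost.\<close>
    moreover have "(norm u)\<^sup>2 = (1 - t) * (norm a)\<^sup>2 + t * (norm z)\<^sup>2 - t * (1 - t) * (norm (z - a))\<^sup>2"
      unfolding u_def power2_norm_eq_inner
      by (simp add: inner_add_left inner_add_right inner_diff_left inner_diff_right inner_commute
          algebra_simps)
    moreover have "(1 - t) * (h a - m / 2 * A) + t * (h z - m / 2 * Z)
        + m / 2 * ((1 - t) * A + t * Z - t * (1 - t) * N)
        = (1 - t) * h a + t * h z - t * ((1 - t) * (m / 2 * N))" for A Z N
      by (simp add: field_simps)
    ultimately have "h a \<le> (1 - t) * h a + t * h z - t * ((1 - t) * (m / 2 * (norm (z - a))\<^sup>2))"
      by (smt (verit))
    then have "t * ((1 - t) * (m / 2 * (norm (z - a))\<^sup>2)) \<le> t * (h z - h a)"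
      by (simp add: algebra_simps)
    then show ?thesis
      using t by simp
  qed
  have "((\<lambda>t. (1 - t) * (m / 2 * (norm (z - a))\<^sup>2)) \<longlongrightarrow> (1 - 0) * (m / 2 * (norm (z - a))\<^sup>2)) (at_right 0)"
    by (intro tendsto_intros)
  moreover have "\<forall>\<^sub>F t in at_right 0. (1 - t) * (m / 2 * (norm (z - a))\<^sup>2) \<le> h z - h a"
    using eventually_at_right_real[of 0 1] by (rule eventually_mono[OF _ step]) auto
  ultimately have "(1 - 0) * (m / 2 * (norm (z - a))\<^sup>2) \<le> h z - h a"
    by (rule tendsto_upperbound) simp
  then show ?thesis
    by simp
qed

section \<open>Projections and normal cones\<close>

lemma normal_cone_closest_point:
  fixes S :: "'a::euclidean_space set"
  assumes "convex S" "closed S" "S \<noteq> {}"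
  shows "a - closest_point S a \<in> normal_cone S (closest_point S a)"
  using assms closest_point_in_set[of S a] closest_point_dot[of S _ a]
  by (auto simp: normal_cone_def)

lemma normal_cone_scaleR: "v \<in> normal_cone S w \<Longrightarrow> 0 \<le> c \<Longrightarrow> c *\<^sub>R v \<in> normal_cone S w"
  by (auto simp: normal_cone_def mult_nonneg_nonpos)

lemma zero_in_normal_cone: "w \<in> S \<Longrightarrow> 0 \<in> normal_cone S w"
  by (simp add: normal_cone_def)

text \<open>The normal cone map has closed graph, since each defining inequality passes to the
  limit. \<open>eta_attained\<close> relies on it to keep a limit of cone elements in the
  cone.\<close>

lemma normal_cone_limit:
  assumes "\<And>n. v n \<in> normal_cone S (w n)" "v \<longlonglongrightarrow> a" "w \<longlonglongrightarrow> b" "b \<in> S"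
  shows "a \<in> normal_cone S b"
  unfolding normal_cone_def
proof (intro CollectI conjI ballI)
  fix u assume "u \<in> S"
  have "(\<lambda>n. v n \<bullet> (u - w n)) \<longlonglongrightarrow> a \<bullet> (u - b)"
    by (intro tendsto_intros assms)
  then show "a \<bullet> (u - b) \<le> 0"
    by (rule LIMSEQ_le_const2) (use assms(1) \<open>u \<in> S\<close> in \<open>auto simp: normal_cone_def\<close>)
qed (fact assms)

section \<open>The regularized value function\<close>

text \<open>Gradient of \<open>psi P z\<close> in w with z frozen, the quantity that Danskin's
  formula evaluates at the minimizer. Its first part is cut out of the full gradient of
  \<open>fun_g\<close>, so that the constant \<open>lip_g\<close> applies to it.\<close>

definition psi_grad ::
  "('n::finite, 'm::finite) ivsp \<Rightarrow> real ^ 'm \<Rightarrow> (real ^ 'n) \<times> (real ^ 'm) \<Rightarrow> (real ^ 'n) \<times> (real ^ 'm)" where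
  "psi_grad P z w = (fst (grad (fun_g P) (fst w, z)), (1 / rho P) *\<^sub>R (snd w - z))"

locale bilevel =
  fixes P :: "('n::finite, 'm::finite) ivsp"
  assumes setting: "bilevel_setting P"
begin

lemma convex_feas: "convex (feas P)"
  using setting by (auto simp: bilevel_setting_def feas_def intro: convex_Times)

lemma compact_feas: "compact (feas P)"
  using setting by (auto simp: bilevel_setting_def feas_def intro: compact_Times)

lemma feas_nonempty: "feas P \<noteq> {}"
  using setting by (auto simp: bilevel_setting_def feas_def)

lemma closed_feas: "closed (feas P)"
  using compact_feas by (rule compact_imp_closed)

lemma rho_pos: "0 < rho P"
  using setting by (auto simp: bilevel_setting_def)

lemma m_rho_pos: "0 < m_rho P"
  using setting by (auto simp: bilevel_setting_def m_rho_def field_simps)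

lemma feas_replace: "w \<in> feas P \<Longrightarrow> z \<in> dom_y P \<Longrightarrow> (fst w, z) \<in> feas P"
  by (auto simp: feas_def)

lemma differentiable_fun_f: "w \<in> feas P \<Longrightarrow> fun_f P differentiable (at w)"
  using setting by (auto simp: bilevel_setting_def C1_near_def)

lemma differentiable_fun_g: "w \<in> feas P \<Longrightarrow> fun_g P differentiable (at w)"
  using setting by (auto simp: bilevel_setting_def C1_near_def)

lemma lipschitz_grad_f: "(lip_f P)-lipschitz_on (feas P) (grad (fun_f P))"
  using setting by (auto simp: bilevel_setting_def)

lemma lipschitz_grad_g: "(lip_g P)-lipschitz_on (feas P) (grad (fun_g P))"
  using setting by (auto simp: bilevel_setting_def)

lemma lipschitz_gradR: "(lip_R P)-lipschitz_on (feas P) (gradR P)"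
  using setting by (auto simp: bilevel_setting_def)

lemma bnd_R_pos: "0 < bnd_R P"
  using setting by (auto simp: bilevel_setting_def)

lemma norm_gradR_le: "w \<in> feas P \<Longrightarrow> norm (gradR P w) \<le> bnd_R P"
  using setting by (auto simp: bilevel_setting_def)

lemma continuous_fun_g: "continuous_on (feas P) (fun_g P)"
  by (meson continuous_at_imp_continuous_on differentiable_fun_g differentiable_imp_continuous_within)

lemma psi_has_derivative:
  assumes w: "w \<in> feas P" and z: "z \<in> dom_y P"
  shows "(psi P z has_derivative (\<lambda>d. psi_grad P z w \<bullet> d)) (at w within feas P)"
proof -
  have 1: "((\<lambda>w. fun_g P (fst w, z)) has_derivative (\<lambda>d. grad (fun_g P) (fst w, z) \<bullet> (fst d, 0))) (at w)"
    by (rule has_derivative_compose[of "\<lambda>w. (fst w, z)",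
          OF _ has_derivative_grad[OF differentiable_fun_g[OF feas_replace[OF w z]]]])
      (auto intro!: derivative_eq_intros)
  have 2: "((\<lambda>w. 1 / (2 * rho P) * ((z - snd w) \<bullet> (z - snd w))) has_derivative
      (\<lambda>d. 1 / (2 * rho P) * ((z - snd w) \<bullet> (- snd d) + (- snd d) \<bullet> (z - snd w)))) (at w)"
    by (intro has_derivative_mult_right has_derivative_inner) (auto intro!: derivative_eq_intros)
  have "(psi P z has_derivative (\<lambda>d. psi_grad P z w \<bullet> d)) (at w)"
  proof (rule has_derivative_eq_rhs)
    show "(psi P z has_derivative (\<lambda>d. grad (fun_g P) (fst w, z) \<bullet> (fst d, 0)
        + 1 / (2 * rho P) * ((z - snd w) \<bullet> (- snd d) + (- snd d) \<bullet> (z - snd w)))) (at w)"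
      using has_derivative_add[OF 1 2] unfolding psi_def[abs_def] power2_norm_eq_inner .
    show "(\<lambda>d. grad (fun_g P) (fst w, z) \<bullet> (fst d, 0)
        + 1 / (2 * rho P) * ((z - snd w) \<bullet> (- snd d) + (- snd d) \<bullet> (z - snd w)))
        = (\<lambda>d. psi_grad P z w \<bullet> d)"
    proof
      fix d :: "(real ^ 'n) \<times> (real ^ 'm)"
      have "(- snd d) \<bullet> (z - snd w) = (snd w - z) \<bullet> snd d"
        "(z - snd w) \<bullet> (- snd d) = (snd w - z) \<bullet> snd d"
        by (simp_all add: inner_diff_left inner_diff_right inner_commute)
      then show "grad (fun_g P) (fst w, z) \<bullet> (fst d, 0)
        + 1 / (2 * rho P) * ((z - snd w) \<bullet> (- snd d) + (- snd d) \<bullet> (z - snd w))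
        = psi_grad P z w \<bullet> d"
        by (simp add: psi_grad_def inner_prod_def)
    qed
  qed
  then show ?thesis
    by (rule has_derivative_at_withinI)
qed

text \<open>Used in two ways: with z fixed it bounds the curvature of \<open>psi P z\<close>, with w
  fixed it prices the exchange of one minimizer for another.\<close>

lemma psi_grad_diff:
  assumes w: "w \<in> feas P" "w' \<in> feas P" and z: "z \<in> dom_y P" "z' \<in> dom_y P"
  shows "norm (psi_grad P z w - psi_grad P z' w') \<le> (lip_g P + 1 / rho P) * (norm (w - w') + norm (z - z'))"
proof -
  have nf: "norm (fst w - fst w') \<le> norm (w - w')"
    by (metis fst_diff norm_fst_le prod.collapse)
  have ns: "norm (snd w - snd w') \<le> norm (w - w')"
    by (metis snd_diff norm_snd_le prod.collapse)
  have l0: "0 \<le> lip_g P"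
    using lipschitz_grad_g lipschitz_on_nonneg by blast
  let ?A = "grad (fun_g P) (fst w, z) - grad (fun_g P) (fst w', z')"
  have "norm (fst ?A) \<le> norm ?A"
    by (metis norm_fst_le prod.collapse)
  also have "\<dots> \<le> lip_g P * norm ((fst w, z) - (fst w', z'))"
    using lipschitz_onD[OF lipschitz_grad_g feas_replace[OF w(1) z(1)] feas_replace[OF w(2) z(2)]]
    by (simp add: dist_norm)
  also have "\<dots> \<le> lip_g P * (norm (w - w') + norm (z - z'))"
    using norm_Pair_le[of "fst w - fst w'" "z - z'"] nf l0 by (intro mult_left_mono) auto
  finally have a: "norm (fst ?A) \<le> lip_g P * (norm (w - w') + norm (z - z'))" .
  let ?B = "(1 / rho P) *\<^sub>R (snd w - z) - (1 / rho P) *\<^sub>R (snd w' - z')"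
  have "?B = (1 / rho P) *\<^sub>R ((snd w - snd w') - (z - z'))"
    by (simp add: algebra_simps)
  then have "norm ?B = 1 / rho P * norm ((snd w - snd w') - (z - z'))"
    using rho_pos by simp
  also have "\<dots> \<le> 1 / rho P * (norm (w - w') + norm (z - z'))"
    using rho_pos ns norm_triangle_ineq4[of "snd w - snd w'" "z - z'"] by (intro mult_left_mono) auto
  finally have b: "norm ?B \<le> 1 / rho P * (norm (w - w') + norm (z - z'))" .
  have "norm (psi_grad P z w - psi_grad P z' w') \<le> norm (fst ?A) + norm ?B"
    using norm_Pair_le[of "fst ?A" ?B] by (simp add: psi_grad_def)
  then show ?thesis
    using a b by (simp add: algebra_simps)
qed

lemma lipschitz_psi_grad:
  assumes z: "z \<in> dom_y P"
  shows "(lip_g P + 1 / rho P)-lipschitz_on (feas P) (psi_grad P z)"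
proof (rule lipschitz_onI)
  show "0 \<le> lip_g P + 1 / rho P"
    using lipschitz_on_nonneg[OF lipschitz_grad_g] rho_pos by simp
  show "dist (psi_grad P z w) (psi_grad P z w') \<le> (lip_g P + 1 / rho P) * dist w w'"
    if "w \<in> feas P" "w' \<in> feas P" for w w'
    using psi_grad_diff[OF that z z] by (simp add: dist_norm)
qed

section \<open>The lower-level minimizer and Danskin's formula\<close>

lemma continuous_psi:
  assumes w: "w \<in> feas P"
  shows "continuous_on (dom_y P) (\<lambda>z. psi P z w)"
  unfolding psi_def
  by (intro continuous_intros continuous_on_compose2[OF continuous_fun_g])
    (auto intro: feas_replace[OF w])

text \<open>The proximal term contributes curvature 1/rho and the weak convexity of g costs sigma,
  whence the modulus \<open>m_rho\<close>. Subtracting it leaves a convex function plus the affine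
  remnant \<open>?l\<close> of the proximal term.\<close>

lemma convex_psi:
  assumes w: "w \<in> feas P"
  shows "convex_on (dom_y P) (\<lambda>z. psi P z w - m_rho P / 2 * (norm z)\<^sup>2)"
proof -
  let ?l = "\<lambda>z. 1 / (2 * rho P) * ((norm (snd w))\<^sup>2 - 2 * (z \<bullet> snd w))"
  have "convex_on (dom_y P) (\<lambda>z. fun_g P (fst w, z) + sigma P / 2 * (norm z)\<^sup>2)"
    using setting w by (auto simp: bilevel_setting_def feas_def)
  moreover have "convex_on (dom_y P) ?l"
  proof (rule convex_onI)
    have "c * (N - 2 * (((1 - t) *\<^sub>R x + t *\<^sub>R y) \<bullet> s))
        = (1 - t) * (c * (N - 2 * (x \<bullet> s))) + t * (c * (N - 2 * (y \<bullet> s)))"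
      for c N t :: real and x y s :: "real ^ 'm"
      by (simp add: inner_add_left algebra_simps)
    then show "?l ((1 - t) *\<^sub>R x + t *\<^sub>R y) \<le> (1 - t) * ?l x + t * ?l y" for t x y
      by simp
  qed (use setting in \<open>auto simp: bilevel_setting_def\<close>)
  ultimately have "convex_on (dom_y P) (\<lambda>z. (fun_g P (fst w, z) + sigma P / 2 * (norm z)\<^sup>2) + ?l z)"
    by (rule convex_on_add)
  moreover have "(fun_g P (fst w, z) + sigma P / 2 * (norm z)\<^sup>2) + ?l z
      = psi P z w - m_rho P / 2 * (norm z)\<^sup>2" for z
  proof -
    have "(norm (z - snd w))\<^sup>2 = (norm z)\<^sup>2 - 2 * (z \<bullet> snd w) + (norm (snd w))\<^sup>2"
      unfolding power2_norm_eq_inner by (simp add: inner_diff_left inner_diff_right inner_commute)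
    moreover have "1 / (2 * rho P) = 1 / rho P / 2"
      by simp
    moreover have "(G + s / 2 * Z) + r / 2 * (S - 2 * q) = G + r / 2 * (Z - 2 * q + S) - (r - s) / 2 * Z"
      for G s Z r S q :: real
      by (simp add: field_simps)
    ultimately show ?thesis
      unfolding psi_def m_rho_def by metis
  qed
  ultimately show ?thesis
    by simp
qed

text \<open>Compactness gives a minimizer, and quadratic growth forces any second one to coincide
  with it, so the description \<open>z_rho\<close> is well defined.\<close>

lemma z_rho_minimizer:
  assumes w: "w \<in> feas P"
  shows "z_rho P w \<in> dom_y P" "z \<in> dom_y P \<Longrightarrow> psi P (z_rho P w) w \<le> psi P z w"
proof -
  have Y: "compact (dom_y P)" "dom_y P \<noteq> {}" "convex (dom_y P)"
    using setting by (auto simp: bilevel_setting_def)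
  obtain a where a: "a \<in> dom_y P" "\<forall>z\<in>dom_y P. psi P a w \<le> psi P z w"
    using continuous_attains_inf[OF Y(1,2) continuous_psi[OF w]] by blast
  have "z_rho P w = a"
    unfolding z_rho_def
  proof (rule the_equality)
    fix b assume b: "b \<in> dom_y P \<and> (\<forall>z'\<in>dom_y P. psi P b w \<le> psi P z' w)"
    have "m_rho P / 2 * (norm (b - a))\<^sup>2 \<le> psi P b w - psi P a w"
      by (rule minimizer_quadratic_growth[OF Y(3) convex_psi[OF w]]) (use a b in auto)
    also have "\<dots> \<le> 0"
      using a b by auto
    finally have "(norm (b - a))\<^sup>2 \<le> 0"
      using m_rho_pos by (simp add: mult_le_0_iff)
    then show "b = a"
      by simp
  qed (use a in auto)
  then show "z_rho P w \<in> dom_y P" "z \<in> dom_y P \<Longrightarrow> psi P (z_rho P w) w \<le> psi P z w"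
    using a by auto
qed

lemma g_rho_eq: "w \<in> feas P \<Longrightarrow> g_rho P w = psi P (z_rho P w) w"
  unfolding g_rho_def by (rule cInf_eq_minimum) (auto intro: z_rho_minimizer)

lemma g_rho_le: "w \<in> feas P \<Longrightarrow> z \<in> dom_y P \<Longrightarrow> g_rho P w \<le> psi P z w"
  by (simp add: g_rho_eq z_rho_minimizer)

lemma psi_growth:
  assumes w: "w \<in> feas P" and z: "z \<in> dom_y P"
  shows "m_rho P / 2 * (norm (z - z_rho P w))\<^sup>2 \<le> psi P z w - g_rho P w"
  unfolding g_rho_eq[OF w]
  by (rule minimizer_quadratic_growth[OF _ convex_psi[OF w]])
    (use setting z z_rho_minimizer[OF w] in \<open>auto simp: bilevel_setting_def\<close>)

lemma gradR_eq:
  assumes w: "w \<in> feas P"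
  shows "gradR P w = grad (fun_g P) w - psi_grad P (z_rho P w) w"
proof -
  have "(fst w, z_rho P w) \<in> feas P"
    using feas_replace[OF w] z_rho_minimizer[OF w] by blast
  then show ?thesis
    using differentiable_fun_g w
    by (simp add: gradR_def gradR_inexact_def psi_grad_def grad_x_eq grad_y_eq prod_eq_iff)
qed

text \<open>Since the gradient of the residual is assumed Lipschitz, its second component already controls
  the lower-level solution; no sensitivity analysis of the minimizer is needed.\<close>

lemma z_rho_diff:
  assumes w: "w \<in> feas P" "w' \<in> feas P"
  shows "norm (z_rho P w' - z_rho P w) \<le> (1 + rho P * (lip_g P + lip_R P)) * norm (w' - w)"
proof -
  let ?h = "\<lambda>w. grad (fun_g P) w - gradR P w"
  have z: "z_rho P v = snd v - rho P *\<^sub>R snd (?h v)" if "v \<in> feas P" for v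
    using rho_pos by (simp add: gradR_eq[OF that] psi_grad_def)
  have "z_rho P w' - z_rho P w = snd ((w' - w) - rho P *\<^sub>R (?h w' - ?h w))"
    by (simp add: z w algebra_simps)
  then have "norm (z_rho P w' - z_rho P w) \<le> norm ((w' - w) - rho P *\<^sub>R (?h w' - ?h w))"
    by (metis norm_snd_le prod.collapse)
  also have "\<dots> \<le> norm (w' - w) + rho P * norm (?h w' - ?h w)"
    using norm_triangle_ineq4[of "w' - w" "rho P *\<^sub>R (?h w' - ?h w)"] rho_pos by simp
  also have "norm (?h w' - ?h w) \<le> (lip_g P + lip_R P) * norm (w' - w)"
    using lipschitz_onD[OF lipschitz_on_diff[OF lipschitz_grad_g lipschitz_gradR] w(2,1)]
    by (simp add: dist_norm)
  finally show ?thesis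
    using rho_pos by (simp add: algebra_simps)
qed

text \<open>Danskin's theorem with a quadratic remainder: the minimizer of w is a competitor at v,
  giving the upper bound, and the minimizer of v is a competitor at w, giving the lower one.\<close>

lemma g_rho_has_derivative:
  assumes w: "w \<in> feas P"
  shows "(g_rho P has_derivative (\<lambda>d. psi_grad P (z_rho P w) w \<bullet> d)) (at w within feas P)"
proof (rule has_derivative_of_quadratic_error)
  define L where "L = lip_g P + 1 / rho P"
  define K where "K = 1 + rho P * (lip_g P + lip_R P)"
  fix v assume v: "v \<in> feas P"
  let ?z = "z_rho P w" and ?y = "z_rho P v"
  have Y: "?z \<in> dom_y P" "?y \<in> dom_y P"
    using z_rho_minimizer w v by auto
  have L: "0 \<le> L"
    using lipschitz_on_nonneg[OF lipschitz_grad_g] rho_pos by (simp add: L_def)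
  have q: "\<bar>psi P z v - psi P z w - psi_grad P z w \<bullet> (v - w)\<bar> \<le> L / 2 * (norm (v - w))\<^sup>2"
    if "z \<in> dom_y P" for z
    unfolding L_def
    by (rule lipschitz_gradient_bound[OF convex_feas w v psi_has_derivative lipschitz_psi_grad])
      (use that in auto)
  have "g_rho P v - g_rho P w \<le> psi P ?z v - psi P ?z w"
    using g_rho_le[OF v Y(1)] by (simp add: g_rho_eq[OF w])
  then have upper: "g_rho P v - g_rho P w - psi_grad P ?z w \<bullet> (v - w) \<le> L / 2 * (norm (v - w))\<^sup>2"
    using q[OF Y(1)] by linarith
  have "psi P ?y v - psi P ?y w \<le> g_rho P v - g_rho P w"
    using g_rho_le[OF w Y(2)] by (simp add: g_rho_eq[OF v])
  then have lower: "- (L / 2 * (norm (v - w))\<^sup>2) \<le> g_rho P v - g_rho P w - psi_grad P ?y w \<bullet> (v - w)"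
    using q[OF Y(2)] by linarith
  \<comment> \<open>The lower bound carries the gradient at the minimizer of v. As the minimizer
    moves at most K times as far as the point, replacing it by that of w costs only a second-order
    term.\<close>
  have "\<bar>(psi_grad P ?y w - psi_grad P ?z w) \<bullet> (v - w)\<bar> \<le> norm (psi_grad P ?y w - psi_grad P ?z w) * norm (v - w)"
    by (rule Cauchy_Schwarz_ineq2)
  also have "\<dots> \<le> (L * norm (?y - ?z)) * norm (v - w)"
    using psi_grad_diff[OF w w Y(2,1)] by (intro mult_right_mono) (auto simp: L_def)
  also have "\<dots> \<le> (L * (K * norm (v - w))) * norm (v - w)"
    using z_rho_diff[OF w v] L by (intro mult_right_mono mult_left_mono) (auto simp: K_def)
  finally have "\<bar>psi_grad P ?y w \<bullet> (v - w) - psi_grad P ?z w \<bullet> (v - w)\<bar> \<le> L * K * (norm (v - w))\<^sup>2"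
    by (simp add: inner_diff_left power2_eq_square mult.assoc)
  moreover have "0 \<le> L * K * (norm (v - w))\<^sup>2"
    using calculation by linarith
  moreover have "(L / 2 + L * K) * (norm (v - w))\<^sup>2 = L / 2 * (norm (v - w))\<^sup>2 + L * K * (norm (v - w))\<^sup>2"
    by (simp add: algebra_simps)
  ultimately show "\<bar>g_rho P v - g_rho P w - psi_grad P ?z w \<bullet> (v - w)\<bar> \<le> (L / 2 + L * K) * (norm (v - w))\<^sup>2"
    using upper lower by linarith
qed

section \<open>The residual and its inexact evaluation\<close>

lemma R_has_derivative:
  assumes w: "w \<in> feas P"
  shows "(R_val P has_derivative (\<lambda>d. gradR P w \<bullet> d)) (at w within feas P)"
proof -
  have "(fun_g P has_derivative (\<lambda>d. grad (fun_g P) w \<bullet> d)) (at w within feas P)"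
    by (rule has_derivative_at_withinI[OF has_derivative_grad[OF differentiable_fun_g[OF w]]])
  then have "((\<lambda>w. fun_g P w - g_rho P w - delta P) has_derivative
      (\<lambda>d. grad (fun_g P) w \<bullet> d - psi_grad P (z_rho P w) w \<bullet> d - 0)) (at w within feas P)"
    by (intro has_derivative_diff g_rho_has_derivative w has_derivative_const)
  moreover have "R_val P = (\<lambda>w. fun_g P w - g_rho P w - delta P)"
    by (simp add: fun_eq_iff R_val_def)
  ultimately show ?thesis
    by (simp add: gradR_eq[OF w] inner_diff_left)
qed

lemma lipschitz_R: "(bnd_R P)-lipschitz_on (feas P) (R_val P)"
proof (rule lipschitz_onI)
  show "dist (R_val P v) (R_val P w) \<le> bnd_R P * dist v w" if "v \<in> feas P" "w \<in> feas P" for v w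
  proof -
    have "norm (R_val P v - R_val P w) \<le> bnd_R P * norm (v - w)"
    proof (rule differentiable_bound[OF convex_feas R_has_derivative])
      show "onorm ((\<bullet>) (gradR P u)) \<le> bnd_R P" if "u \<in> feas P" for u
      proof (rule onorm_bound)
        show "norm (gradR P u \<bullet> d) \<le> bnd_R P * norm d" for d
          using Cauchy_Schwarz_ineq2[of "gradR P u" d]
            mult_right_mono[OF norm_gradR_le[OF that] norm_ge_zero[of d]] by simp
      qed (use bnd_R_pos in simp)
    qed (use that in auto)
    then show ?thesis
      by (simp add: dist_norm)
  qed
qed (use bnd_R_pos in simp)

text \<open>\<open>psi\<close> lies above its minimum, so the inexact residual errs only downwards:
  a positive value certifies a positive exact residual, and adding the accuracy gives an upper
  bound.\<close>

lemma accurate_R_inexact: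
  assumes "accurate P e z w"
  shows "R_inexact P z w \<le> R_val P w" "R_val P w \<le> R_inexact P z w + e"
  using assms by (auto simp: accurate_def R_inexact_def R_val_def)

text \<open>The two components of the error are bounded by \<open>lip_xy\<close> and 1/rho times the
  distance to the minimizer. Their Euclidean combination is \<open>L_a\<close>, and quadratic growth
  bounds the distance.\<close>

lemma accurate_gradR_inexact:
  assumes w: "w \<in> feas P" and acc: "accurate P e z w"
  shows "norm (gradR_inexact P z w - gradR P w) \<le> D_rho P e"
proof -
  let ?z = "z_rho P w"
  have z: "z \<in> dom_y P" and e: "psi P z w - g_rho P w \<le> e"
    using acc by (auto simp: accurate_def)
  have "m_rho P / 2 * (norm (z - ?z))\<^sup>2 \<le> e"
    using psi_growth[OF w z] e by linarith
  then have "(norm (z - ?z))\<^sup>2 \<le> 2 * e / m_rho P"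
    using m_rho_pos by (simp add: field_simps)
  then have zz: "norm (z - ?z) \<le> sqrt (2 * e / m_rho P)"
    by (rule real_le_rsqrt)
  let ?a = "grad_x (fun_g P) (fst w) ?z - grad_x (fun_g P) (fst w) z"
  let ?b = "(1 / rho P) *\<^sub>R (z - ?z)"
  have "(lip_xy P)-lipschitz_on (dom_y P) (\<lambda>y. grad_x (fun_g P) (fst w) y)"
    using setting w by (auto simp: bilevel_setting_def feas_def)
  from lipschitz_onD[OF this z_rho_minimizer(1)[OF w] z]
  have "norm ?a \<le> lip_xy P * norm (z - ?z)"
    by (simp add: dist_norm norm_minus_commute)
  then have "(norm ?a)\<^sup>2 \<le> (lip_xy P * norm (z - ?z))\<^sup>2"
    by (intro power_mono) auto
  moreover have "(norm ?b)\<^sup>2 = (1 / rho P * norm (z - ?z))\<^sup>2"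
    using rho_pos by simp
  moreover have "gradR_inexact P z w - gradR P w = (?a, ?b)"
    by (simp add: gradR_def gradR_inexact_def algebra_simps)
  ultimately have "norm (gradR_inexact P z w - gradR P w)
      \<le> sqrt ((lip_xy P * norm (z - ?z))\<^sup>2 + (1 / rho P * norm (z - ?z))\<^sup>2)"
    by (simp add: norm_Pair)
  also have "\<dots> = L_a P * norm (z - ?z)"
  proof -
    have "(lip_xy P * norm (z - ?z))\<^sup>2 + (1 / rho P * norm (z - ?z))\<^sup>2
        = ((lip_xy P)\<^sup>2 + (1 / rho P)\<^sup>2) * (norm (z - ?z))\<^sup>2"
      by (simp add: power_mult_distrib distrib_right power_divide)
    then show ?thesis
      by (simp add: L_a_def real_sqrt_mult)
  qed
  also have "\<dots> \<le> D_rho P e"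
    unfolding D_rho_def by (intro mult_left_mono zz) (simp add: L_a_def)
  finally show ?thesis .
qed

end

section \<open>The smoothed penalty\<close>

lemma lipschitz_scaleR_bounded:
  fixes D :: "'a::metric_space \<Rightarrow> 'b::real_normed_vector" and c :: "'a \<Rightarrow> real"
  assumes c: "M-lipschitz_on S c" "\<And>w. w \<in> S \<Longrightarrow> \<bar>c w\<bar> \<le> 1"
    and D: "K-lipschitz_on S D" "\<And>w. w \<in> S \<Longrightarrow> norm (D w) \<le> B" and B: "0 \<le> B"
  shows "(M * B + K)-lipschitz_on S (\<lambda>w. c w *\<^sub>R D w)"
proof (rule lipschitz_onI)
  show "0 \<le> M * B + K"
    using lipschitz_on_nonneg[OF c(1)] lipschitz_on_nonneg[OF D(1)] B by simp
  fix v w assume v: "v \<in> S" and w: "w \<in> S"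
  have "c v *\<^sub>R D v - c w *\<^sub>R D w = (c v - c w) *\<^sub>R D v + c w *\<^sub>R (D v - D w)"
    by (simp add: algebra_simps)
  then have "dist (c v *\<^sub>R D v) (c w *\<^sub>R D w) \<le> \<bar>c v - c w\<bar> * norm (D v) + \<bar>c w\<bar> * norm (D v - D w)"
    unfolding dist_norm by (metis norm_scaleR norm_triangle_ineq)
  also have "\<bar>c v - c w\<bar> * norm (D v) \<le> (M * dist v w) * B"
    using lipschitz_onD[OF c(1) v w] D(2)[OF v] lipschitz_on_nonneg[OF c(1)]
    by (intro mult_mono) (auto simp: dist_real_def)
  also have "\<bar>c w\<bar> * norm (D v - D w) \<le> 1 * (K * dist v w)"
    using lipschitz_onD[OF D(1) v w] c(2)[OF w] by (intro mult_mono) (auto simp: dist_norm)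
  finally show "dist (c v *\<^sub>R D v) (c w *\<^sub>R D w) \<le> (M * B + K) * dist v w"
    by (simp add: algebra_simps)
qed

text \<open>Chain-rule gradient on C of the exact smoothed penalty
  \<open>phi P \<nu> (R_val P w)\<close>; \<open>gradG_it\<close> is its inexact
  counterpart.\<close>

definition G_grad ::
  "('n::finite, 'm::finite) ivsp \<Rightarrow> real \<Rightarrow> (real ^ 'n) \<times> (real ^ 'm) \<Rightarrow> (real ^ 'n) \<times> (real ^ 'm)" where
  "G_grad P \<nu> w = deriv (phi P \<nu>) (R_val P w) *\<^sub>R gradR P w"

locale smoothed_bilevel = bilevel P for P :: "('n::finite, 'm::finite) ivsp" +
  assumes smoothing: "smoothing_family P"
begin

lemma sm_b_nonneg: "0 \<le> sm_b P"
  using smoothing by (simp add: smoothing_family_def)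

lemma a_phi_pos: "0 < a_phi P"
  using smoothing by (simp add: smoothing_family_def)

lemma phi_has_derivative:
  "0 < \<nu> \<Longrightarrow> (phi P \<nu> has_real_derivative deriv (phi P \<nu>) s) (at s)"
  using smoothing by (simp add: smoothing_family_def DERIV_deriv_iff_real_differentiable)

lemma deriv_phi_bounds:
  assumes "0 < \<nu>"
  shows "0 \<le> deriv (phi P \<nu>) s" "deriv (phi P \<nu>) s \<le> 1"
  using smoothing assms by (simp_all add: smoothing_family_def)

lemma deriv_phi_diff:
  "0 < \<nu> \<Longrightarrow> \<bar>deriv (phi P \<nu>) s - deriv (phi P \<nu>) r\<bar> \<le> sm_b P / \<nu> * \<bar>s - r\<bar>"
  using smoothing unfolding smoothing_family_def by blast

lemma phi_mono: "0 < \<nu> \<Longrightarrow> r \<le> s \<Longrightarrow> phi P \<nu> r \<le> phi P \<nu> s"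
  using smoothing by (auto simp: smoothing_family_def dest: monoD)

text \<open>Slope at most 1 makes \<open>phi P \<nu> x - x\<close> nonincreasing. An error in the
  residual thus costs at most itself in the penalty, which is where the two \<open>zeta\<close>
  terms of \<open>tau\<close> come from.\<close>

lemma phi_add_le:
  assumes \<nu>: "0 < \<nu>" and e: "0 \<le> e"
  shows "phi P \<nu> (s + e) \<le> phi P \<nu> s + e"
proof -
  have "phi P \<nu> (s + e) - (s + e) \<le> phi P \<nu> s - s"
  proof (rule DERIV_nonpos_imp_nonincreasing[of s "s + e" "\<lambda>x. phi P \<nu> x - x"])
    fix x
    have "((\<lambda>x. phi P \<nu> x - x) has_real_derivative deriv (phi P \<nu>) x - 1) (at x)"
      by (intro DERIV_diff phi_has_derivative \<nu> DERIV_ident)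
    then show "\<exists>y. ((\<lambda>x. phi P \<nu> x - x) has_real_derivative y) (at x) \<and> y \<le> 0"
      using deriv_phi_bounds(2)[OF \<nu>, of x] by (intro exI[of _ "deriv (phi P \<nu>) x - 1"]) simp
  qed (use e in simp)
  then show ?thesis
    by simp
qed

text \<open>The secant slope between 0 and s is at least 1 - a_phi nu / s, and by convexity the
  derivative at s dominates it.\<close>

lemma deriv_phi_gt_half:
  assumes \<nu>: "0 < \<nu>" and s: "2 * a_phi P * \<nu> < s"
  shows "1 / 2 < deriv (phi P \<nu>) s"
proof -
  have s0: "0 < s"
    using s a_phi_pos \<nu> by (smt (verit) mult_pos_pos)
  have b: "max t 0 - sm_a1 P * \<nu> \<le> phi P \<nu> t \<and> phi P \<nu> t \<le> max t 0 + sm_a2 P * \<nu>" for t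
    using smoothing \<nu> unfolding smoothing_family_def by blast
  have "convex_on UNIV (phi P \<nu>)"
    using smoothing \<nu> unfolding smoothing_family_def by blast
  then have "deriv (phi P \<nu>) s * (0 - s) \<le> phi P \<nu> 0 - phi P \<nu> s"
    by (rule convex_on_imp_above_tangent) (use phi_has_derivative[OF \<nu>] in auto)
  moreover have "phi P \<nu> 0 \<le> sm_a2 P * \<nu>" "s - sm_a1 P * \<nu> \<le> phi P \<nu> s"
    using b[of 0] b[of s] s0 by auto
  moreover have "2 * (sm_a1 P * \<nu>) + 2 * (sm_a2 P * \<nu>) < s"
    using s by (simp add: a_phi_def algebra_simps)
  ultimately have "(1 / 2) * s < deriv (phi P \<nu>) s * s"
    by (simp only: diff_0 mult_minus_right)
  then show ?thesis
    using s0 by (simp only: mult_less_cancel_right_pos)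
qed

lemma phi_R_has_derivative:
  assumes \<nu>: "0 < \<nu>" and w: "w \<in> feas P"
  shows "((\<lambda>w. phi P \<nu> (R_val P w)) has_derivative (\<lambda>d. G_grad P \<nu> w \<bullet> d)) (at w within feas P)"
proof -
  have "(phi P \<nu> has_derivative (\<lambda>d. deriv (phi P \<nu>) (R_val P w) * d)) (at (R_val P w))"
    using phi_has_derivative[OF \<nu>] by (simp add: has_field_derivative_def)
  from has_derivative_compose[OF R_has_derivative[OF w] this] show ?thesis
    by (simp add: G_grad_def)
qed

lemma lipschitz_deriv_phi_R:
  assumes \<nu>: "0 < \<nu>"
  shows "(sm_b P / \<nu> * bnd_R P)-lipschitz_on (feas P) (\<lambda>w. deriv (phi P \<nu>) (R_val P w))"
proof (rule lipschitz_onI)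
  show "0 \<le> sm_b P / \<nu> * bnd_R P"
    using sm_b_nonneg bnd_R_pos \<nu> by simp
  fix v w assume "v \<in> feas P" "w \<in> feas P"
  then have "\<bar>R_val P v - R_val P w\<bar> \<le> bnd_R P * dist v w"
    using lipschitz_onD[OF lipschitz_R] by (simp add: dist_real_def)
  then have "sm_b P / \<nu> * \<bar>R_val P v - R_val P w\<bar> \<le> sm_b P / \<nu> * (bnd_R P * dist v w)"
    using sm_b_nonneg \<nu> by (intro mult_left_mono) auto
  then show "dist (deriv (phi P \<nu>) (R_val P v)) (deriv (phi P \<nu>) (R_val P w))
      \<le> sm_b P / \<nu> * bnd_R P * dist v w"
    using deriv_phi_diff[OF \<nu>, of "R_val P v" "R_val P w"]
    unfolding dist_real_def mult.assoc by linarith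
qed

text \<open>The product rule gives the constant b B^2 / \<nu> + L_R. Bounding \<nu> by
  \<open>mu P 0\<close> in the numerator makes \<open>L_G\<close> independent of the
  iteration.\<close>

lemma lipschitz_G_grad:
  assumes \<nu>: "0 < \<nu>" "\<nu> \<le> mu P 0"
  shows "(L_G P / \<nu>)-lipschitz_on (feas P) (G_grad P \<nu>)"
proof (rule lipschitz_on_le)
  show "(sm_b P / \<nu> * bnd_R P * bnd_R P + lip_R P)-lipschitz_on (feas P) (G_grad P \<nu>)"
    unfolding G_grad_def[abs_def]
  proof (rule lipschitz_scaleR_bounded)
    show "\<bar>deriv (phi P \<nu>) (R_val P w)\<bar> \<le> 1" for w
      using deriv_phi_bounds[OF \<nu>(1), of "R_val P w"] by simp
  qed (use lipschitz_deriv_phi_R[OF \<nu>(1)] lipschitz_gradR norm_gradR_le bnd_R_pos in auto)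
  have "\<nu> * lip_R P \<le> mu P 0 * lip_R P"
    using lipschitz_on_nonneg[OF lipschitz_gradR] \<nu> by (intro mult_right_mono)
  then show "sm_b P / \<nu> * bnd_R P * bnd_R P + lip_R P \<le> L_G P / \<nu>"
    using \<nu> by (simp add: L_G_def field_simps power2_eq_square)
qed

text \<open>The slope part of \<open>E_rho\<close>, kept separate because at a new iterate the
  inexact slope meets the exact gradient.\<close>

lemma deriv_phi_inexact_diff:
  assumes \<nu>: "0 < \<nu>" and w: "w \<in> feas P" and acc: "accurate P e z w"
  shows "norm ((deriv (phi P \<nu>) (R_inexact P z w) - deriv (phi P \<nu>) (R_val P w)) *\<^sub>R gradR P w)
    \<le> sm_b P * bnd_R P / \<nu> * e"
proof -
  let ?d = "\<bar>deriv (phi P \<nu>) (R_inexact P z w) - deriv (phi P \<nu>) (R_val P w)\<bar>"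
  have "?d \<le> sm_b P / \<nu> * \<bar>R_inexact P z w - R_val P w\<bar>"
    by (rule deriv_phi_diff[OF \<nu>])
  also have "\<dots> \<le> sm_b P / \<nu> * e"
    using accurate_R_inexact[OF acc] sm_b_nonneg \<nu> by (intro mult_left_mono) auto
  finally have "?d * norm (gradR P w) \<le> (sm_b P / \<nu> * e) * bnd_R P"
    using norm_gradR_le[OF w] by (intro mult_mono) auto
  then show ?thesis
    by (simp add: mult_ac)
qed

lemma G_grad_inexact:
  assumes \<nu>: "0 < \<nu>" and w: "w \<in> feas P" and acc: "accurate P e z w"
  shows "norm (deriv (phi P \<nu>) (R_inexact P z w) *\<^sub>R gradR_inexact P z w - G_grad P \<nu> w) \<le> E_rho P \<nu> e"
proof -
  let ?p = "deriv (phi P \<nu>) (R_inexact P z w)"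
  let ?A = "?p *\<^sub>R (gradR_inexact P z w - gradR P w)"
  let ?B = "(?p - deriv (phi P \<nu>) (R_val P w)) *\<^sub>R gradR P w"
  have "norm ?A \<le> 1 * D_rho P e"
    unfolding norm_scaleR using deriv_phi_bounds[OF \<nu>] accurate_gradR_inexact[OF w acc]
    by (intro mult_mono) auto
  moreover have "norm ?B \<le> sm_b P * bnd_R P / \<nu> * e"
    by (rule deriv_phi_inexact_diff[OF \<nu> w acc])
  moreover have "?p *\<^sub>R gradR_inexact P z w - G_grad P \<nu> w = ?A + ?B"
    by (simp add: G_grad_def algebra_simps)
  ultimately show ?thesis
    using norm_triangle_ineq[of ?A ?B] by (simp add: E_rho_def)
qed

end

section \<open>The constraint qualification constant and the iteration\<close>

lemma infdist_zero_less:
  fixes A :: "'a::real_normed_vector set"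
  assumes "A \<noteq> {}" "infdist 0 A < c"
  obtains a where "a \<in> A" "norm a < c"
  using assms cInf_lessD[of "(\<lambda>a. dist 0 a) ` A" c] by (auto simp: infdist_notempty)

section \<open>Attainment and positivity of eta\<close>

context bilevel
begin

lemma gradR_cone_nonempty: "w \<in> feas P \<Longrightarrow> gradR_cone P w \<noteq> {}"
  using zero_in_normal_cone[of w "feas P"] unfolding gradR_cone_def by blast

lemma eta_le_norm:
  assumes w: "w \<in> R_nonneg P" and v: "v \<in> normal_cone (feas P) w"
  shows "eta P \<le> norm (gradR P w + v)"
proof -
  have "eta P \<le> infdist 0 (gradR_cone P w)"
    unfolding eta_def by (rule cINF_lower[OF bdd_belowI2[of _ 0] w]) (simp add: infdist_nonneg)
  also have "\<dots> \<le> dist 0 (gradR P w + v)"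
    by (rule infdist_le) (use v gradR_cone_def in blast)
  finally show ?thesis
    by simp
qed

text \<open>The distance to the cone need not be continuous in w, since the normal cone jumps at the
  boundary. The argument therefore follows nearly optimal pairs of a point and a cone element,
  extracts a limit by compactness, and uses the closed graph.\<close>

lemma eta_attained:
  assumes ne: "R_nonneg P \<noteq> {}" and cq: "ENNAMCQ P"
  shows "\<exists>w\<in>R_nonneg P. eta P = infdist 0 (gradR_cone P w)" "0 < eta P"
proof -
  have "\<exists>w\<in>R_nonneg P. \<exists>e\<in>gradR_cone P w. norm e < eta P + 1 / real (Suc n)" for n
  proof -
    have "(INF w\<in>R_nonneg P. infdist 0 (gradR_cone P w)) < eta P + 1 / real (Suc n)"
      unfolding eta_def by simp
    then obtain w where w: "w \<in> R_nonneg P" "infdist 0 (gradR_cone P w) < eta P + 1 / real (Suc n)"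
      using cInf_lessD[of "(\<lambda>w. infdist 0 (gradR_cone P w)) ` R_nonneg P"] ne by blast
    \<comment> \<open>\<open>infdist\<close> to the empty set is 0 by convention, so a short cone
      element can be extracted only from a nonempty cone.\<close>
    moreover have "gradR_cone P w \<noteq> {}"
      using gradR_cone_nonempty w(1) by (simp add: R_nonneg_def)
    ultimately show ?thesis
      using infdist_zero_less by blast
  qed
  then obtain w e where w: "\<And>n. w n \<in> R_nonneg P" and e: "\<And>n. e n \<in> gradR_cone P (w n)"
    and le: "\<And>n. norm (e n) < eta P + 1 / real (Suc n)"
    by metis
  have wf: "w n \<in> feas P" for n
    using w[of n] by (simp add: R_nonneg_def)
  have "compact (feas P \<times> cball (0 :: (real ^ 'n) \<times> (real ^ 'm)) (eta P + 1))"
    by (intro compact_Times compact_feas compact_cball)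
  then have seq: "seq_compact (feas P \<times> cball (0 :: (real ^ 'n) \<times> (real ^ 'm)) (eta P + 1))"
    by (simp add: compact_eq_seq_compact_metric)
  have "norm (e n) \<le> eta P + 1" for n
  proof -
    have "1 / real (Suc n) \<le> 1"
      by simp
    then show ?thesis
      using le[of n] by linarith
  qed
  then have "\<forall>n. (w n, e n) \<in> feas P \<times> cball 0 (eta P + 1)"
    using wf by simp
  with seq obtain l r where l: "l \<in> feas P \<times> cball 0 (eta P + 1)" and r: "strict_mono r"
    and lim: "((\<lambda>n. (w n, e n)) \<circ> r) \<longlonglongrightarrow> l"
    by (rule seq_compactE)
  obtain a b where ab: "l = (a, b)"
    by (metis surj_pair)
  have af: "a \<in> feas P"
    using l ab by simp
  have wa: "(\<lambda>n. w (r n)) \<longlonglongrightarrow> a" and eb: "(\<lambda>n. e (r n)) \<longlonglongrightarrow> b"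
    using tendsto_fst[OF lim] tendsto_snd[OF lim] by (simp_all add: ab o_def)
  have "(\<lambda>n. R_val P (w (r n))) \<longlonglongrightarrow> R_val P a"
    by (rule continuous_on_tendsto_compose[OF lipschitz_on_continuous_on[OF lipschitz_R] wa af])
      (use wf in simp)
  then have "0 \<le> R_val P a"
    by (rule LIMSEQ_le_const) (use w in \<open>simp add: R_nonneg_def\<close>)
  then have aR: "a \<in> R_nonneg P"
    using af by (simp add: R_nonneg_def)
  have "(\<lambda>n. gradR P (w (r n))) \<longlonglongrightarrow> gradR P a"
    by (rule continuous_on_tendsto_compose[OF lipschitz_on_continuous_on[OF lipschitz_gradR] wa af])
      (use wf in simp)
  then have diff: "(\<lambda>n. e (r n) - gradR P (w (r n))) \<longlonglongrightarrow> b - gradR P a"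
    by (intro tendsto_diff eb)
  have "e (r n) - gradR P (w (r n)) \<in> normal_cone (feas P) (w (r n))" for n
    using e[of "r n"] unfolding gradR_cone_def by fastforce
  then have "b - gradR P a \<in> normal_cone (feas P) a"
    by (rule normal_cone_limit[OF _ diff wa af])
  then have b: "b \<in> gradR_cone P a"
    unfolding gradR_cone_def by (intro CollectI exI[of _ "b - gradR P a"]) simp
  have "(\<lambda>n. eta P + 1 / real (Suc (r n))) \<longlonglongrightarrow> eta P + 0"
    by (rule tendsto_add[OF tendsto_const])
      (use LIMSEQ_subseq_LIMSEQ[OF LIMSEQ_inverse_real_of_nat r] in \<open>simp add: o_def inverse_eq_divide\<close>)
  then have "norm b \<le> eta P + 0"
    by (rule LIMSEQ_le[OF tendsto_norm[OF eb]]) (use le in \<open>auto intro: less_imp_le\<close>)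
  then have "infdist 0 (gradR_cone P a) \<le> eta P"
    using infdist_le[OF b, of 0] by simp
  moreover have "eta P \<le> infdist 0 (gradR_cone P a)"
    unfolding eta_def by (rule cINF_lower[OF bdd_belowI2[of _ 0] aR]) (simp add: infdist_nonneg)
  ultimately show "\<exists>w\<in>R_nonneg P. eta P = infdist 0 (gradR_cone P w)"
    using aR by (intro bexI[of _ a]) simp_all
  \<comment> \<open>The limit b is a cone element of norm at most eta, so excluding b = 0 by the
    constraint qualification already makes eta positive.\<close>
  have "b \<noteq> 0"
    using b cq aR by (auto simp: ENNAMCQ_def R_nonneg_def)
  then show "0 < eta P"
    using \<open>norm b \<le> eta P + 0\<close> zero_less_norm_iff[of b] by linarith
qed

lemma norm_grad_f_le: "w \<in> feas P \<Longrightarrow> norm (grad (fun_f P) w) \<le> M_f P"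
  unfolding M_f_def
proof (rule cSUP_upper)
  have "compact ((\<lambda>w. norm (grad (fun_f P) w)) ` feas P)"
    by (intro compact_continuous_image compact_feas continuous_on_norm
        lipschitz_on_continuous_on[OF lipschitz_grad_f])
  then show "bdd_above ((\<lambda>w. norm (grad (fun_f P) w)) ` feas P)"
    by (intro bounded_imp_bdd_above compact_imp_bounded)
qed

lemma M_f_nonneg: "0 \<le> M_f P"
  using norm_grad_f_le feas_nonempty norm_ge_zero order_trans by blast

lemma D_rho_mono: "e \<le> e' \<Longrightarrow> D_rho P e \<le> D_rho P e'"
  using m_rho_pos unfolding D_rho_def L_a_def
  by (intro mult_left_mono real_sqrt_le_mono divide_right_mono) auto

end

section \<open>The projection step and the line search\<close>

locale ivsp_iteration = smoothed_bilevel P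
  for P :: "('n::finite, 'm::finite) ivsp" +
  fixes S :: "('n, 'm) trace"
  assumes parameters: "ivsp_parameters P"
    and run: "ivsp_run P S"
begin

lemma mu_pos: "0 < mu P k"
  using parameters by (simp add: ivsp_parameters_def)

lemma mu_le: "mu P k \<le> mu P 0"
  using parameters by (auto simp: ivsp_parameters_def decseq_def)

lemma zeta_pos: "0 < zeta P k"
  using parameters by (simp add: ivsp_parameters_def)

lemma zeta_Suc_le: "zeta P (Suc k) \<le> zeta P k"
  using parameters by (auto simp: ivsp_parameters_def decseq_Suc_iff)

lemma gam_pos: "0 < gam P S k"
  using parameters by (simp add: ivsp_parameters_def gam_def)

lemma grid_antimono: "s \<le> t \<Longrightarrow> grid P t \<le> grid P s"
  by (rule lift_Suc_antimono_le)
    (use parameters in \<open>simp_all add: ivsp_parameters_def less_imp_le\<close>)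

lemma gam_le: "gam P S k \<le> grid P 0"
  by (simp add: gam_def grid_antimono)

lemma th_bounds: "0 < th_lo P" "0 < th_hi P" "th_hi P < 2"
  using parameters by (auto simp: ivsp_parameters_def)

lemma L_G_nonneg: "0 \<le> L_G P"
  using sm_b_nonneg mu_pos[of 0] lipschitz_on_nonneg[OF lipschitz_gradR] by (simp add: L_G_def)

lemma L_safe_pos: "0 < L_safe P"
  using th_bounds by (simp add: L_safe_def less_max_iff_disj)

lemma trial_feas: "trial P S k L \<in> feas P"
  unfolding trial_def by (rule closest_point_in_set[OF closed_feas feas_nonempty])

lemma it_w_feas: "it_w S k \<in> feas P"
  using run trial_feas by (cases k) (auto simp: ivsp_run_def)

lemma it_z_accurate: "accurate P (zeta P k) (it_z S k) (it_w S k)"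
proof (cases k)
  case 0
  then show ?thesis
    using run by (simp add: ivsp_run_def)
next
  case (Suc l)
  have "L_choice P S l" "it_w S k = trial P S l (it_L S l)" "it_z S k = it_zplus S l (it_L S l)"
    using run Suc by (auto simp: ivsp_run_def)
  then show ?thesis
    using Suc by (auto simp: L_choice_def split: strategy.splits)
qed

text \<open>The residual of a projection is normal to C. The factor L / mu gives the search
  direction unit weight.\<close>

lemma trial_normal:
  assumes L: "0 < L"
  shows "- (gam P S k *\<^sub>R grad (fun_f P) (it_w S k) + gradG_it P S k)
    - (L / mu P k) *\<^sub>R (trial P S k L - it_w S k) \<in> normal_cone (feas P) (trial P S k L)"
proof -
  let ?V = "gam P S k *\<^sub>R grad (fun_f P) (it_w S k) + gradG_it P S k"
  have "(L / mu P k) *\<^sub>R (it_w S k - (mu P k / L) *\<^sub>R ?V - trial P S k L)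
      \<in> normal_cone (feas P) (trial P S k L)"
    unfolding trial_def using L mu_pos[of k]
    by (intro normal_cone_scaleR normal_cone_closest_point convex_feas closed_feas feas_nonempty) auto
  moreover have "(L / mu P k) *\<^sub>R (it_w S k - (mu P k / L) *\<^sub>R ?V - trial P S k L)
      = - ?V - (L / mu P k) *\<^sub>R (trial P S k L - it_w S k)"
    using L mu_pos[of k] by (simp add: scaleR_diff_right algebra_simps)
  ultimately show ?thesis
    by simp
qed

lemma trial_descent:
  assumes L: "0 < L"
  shows "(gam P S k *\<^sub>R grad (fun_f P) (it_w S k) + gradG_it P S k) \<bullet> (trial P S k L - it_w S k)
    \<le> - (L / mu P k * (norm (trial P S k L - it_w S k))\<^sup>2)"
proof -
  let ?V = "gam P S k *\<^sub>R grad (fun_f P) (it_w S k) + gradG_it P S k"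
  let ?d = "trial P S k L - it_w S k"
  have "(- ?V - (L / mu P k) *\<^sub>R ?d) \<bullet> (it_w S k - trial P S k L) \<le> 0"
    using trial_normal[OF L, of k] it_w_feas[of k] by (auto simp: normal_cone_def)
  moreover have "it_w S k - trial P S k L = - ?d"
    by simp
  ultimately have "?V \<bullet> ?d + L / mu P k * (?d \<bullet> ?d) \<le> 0"
    by (simp only: inner_minus_right inner_minus_left inner_diff_left inner_scaleR_left)
  then show ?thesis
    by (simp add: power2_norm_eq_inner)
qed

lemma gradG_it_error: "norm (gradG_it P S k - G_grad P (mu P k) (it_w S k)) \<le> E0 P k"
  unfolding gradG_it_def R_it_def E0_def
  by (rule G_grad_inexact[OF mu_pos it_w_feas it_z_accurate])

text \<open>The clamp at \<open>th_lo\<close> could otherwise exceed \<open>th_hi P * L\<close>; the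
  first entry of \<open>L_safe\<close> is there to exclude this.\<close>

lemma vartheta_bounds:
  assumes "th_lo P \<le> th_hi P * L"
  shows "0 < vartheta P S k L" "vartheta P S k L \<le> th_hi P * L"
  using assms th_bounds by (auto simp: vartheta_def)

text \<open>Sums the descent inequalities for f and the smoothed penalty, the projection inequality,
  and the gradient error. The projection supplies -L/m times the squared step, and everything else
  must leave c1 / (2m) of it.\<close>

lemma accepted_if_L_safe_le:
  assumes L: "L_safe P \<le> L"
    and acc: "accurate P (zeta P (Suc k)) (it_zplus S k L) (trial P S k L)"
  shows "accepted P S k L"
proof -
  define w v where "w = it_w S k" and "v = trial P S k L"
  define m \<gamma> \<theta> N where "m = mu P k" and "\<gamma> = gam P S k" and "\<theta> = vartheta P S k L"
    and "N = (norm (v - w))\<^sup>2"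
  have m: "0 < m" and \<gamma>: "0 < \<gamma>"
    using mu_pos gam_pos by (auto simp: m_def \<gamma>_def)
  have L0: "0 < L"
    using L L_safe_pos by linarith
  have wf: "w \<in> feas P" and vf: "v \<in> feas P"
    using it_w_feas trial_feas by (auto simp: w_def v_def)
  have "th_lo P / th_hi P \<le> L" and safe: "(par_c1 P + grid P 0 * mu P 0 * lip_f P + L_G P) / (2 - th_hi P) \<le> L"
    using L by (auto simp: L_safe_def)
  then have "th_lo P \<le> th_hi P * L"
    using th_bounds by (simp add: field_simps)
  note \<theta> = vartheta_bounds[OF this, of k, folded \<theta>_def]
  have f: "fun_f P v \<le> fun_f P w + grad (fun_f P) w \<bullet> (v - w) + lip_f P / 2 * N"
    unfolding N_def
    by (rule lipschitz_gradient_upper[OF convex_feas wf vf _ lipschitz_grad_f])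
      (rule has_derivative_at_withinI[OF has_derivative_grad[OF differentiable_fun_f]])
  have g: "phi P m (R_val P v) \<le> phi P m (R_val P w) + G_grad P m w \<bullet> (v - w) + (L_G P / m) / 2 * N"
    unfolding N_def
    by (rule lipschitz_gradient_upper[OF convex_feas wf vf phi_R_has_derivative lipschitz_G_grad])
      (use m mu_le[of k] in \<open>auto simp: m_def\<close>)
  have proj: "\<gamma> * (grad (fun_f P) w \<bullet> (v - w)) + gradG_it P S k \<bullet> (v - w) \<le> - (L / m * N)"
    using trial_descent[OF L0, of k] by (simp add: w_def v_def m_def \<gamma>_def N_def inner_add_left)
  have "(G_grad P m w - gradG_it P S k) \<bullet> (v - w) \<le> norm (G_grad P m w - gradG_it P S k) * norm (v - w)"
    by (rule norm_cauchy_schwarz)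
  also have "\<dots> \<le> E0 P k * norm (v - w)"
    using gradG_it_error[of k] by (intro mult_right_mono) (auto simp: m_def w_def norm_minus_commute)
  \<comment> \<open>Young's inequality with weight \<theta>: one half becomes the first term of
    \<open>tau\<close>, the other is absorbed by the projection term.\<close>
  also have "\<dots> \<le> m / (2 * \<theta>) * (E0 P k)\<^sup>2 + \<theta> / (2 * m) * N"
  proof -
    have "0 \<le> (m * E0 P k - \<theta> * norm (v - w))\<^sup>2 / (2 * \<theta> * m)"
      using m \<theta> by simp
    also have "\<dots> = m / (2 * \<theta>) * (E0 P k)\<^sup>2 + \<theta> / (2 * m) * N - E0 P k * norm (v - w)"
      using m \<theta> by (simp add: N_def field_simps power2_eq_square)
    finally show ?thesis
      by simp
  qed
  finally have err: "G_grad P m w \<bullet> (v - w) \<le> gradG_it P S k \<bullet> (v - w)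
      + m / (2 * \<theta>) * (E0 P k)\<^sup>2 + \<theta> / (2 * m) * N"
    by (simp add: inner_diff_left)
  \<comment> \<open>Multiplied by 2m, the coefficients must satisfy c1 + \<gamma> m L_f + L_G +
    \<theta> \<le> 2L. With \<theta> at most \<open>th_hi P * L\<close> this is the second entry of
    \<open>L_safe\<close>, hence its denominator.\<close>
  have coeff: "\<gamma> * (lip_f P / 2 * N) + (L_G P / m) / 2 * N + \<theta> / (2 * m) * N - L / m * N
      \<le> - (par_c1 P / (2 * m) * N)"
  proof -
    have "(\<gamma> * m) * lip_f P \<le> (grid P 0 * mu P 0) * lip_f P"
      using gam_le[of k] mu_le[of k] m \<gamma> lipschitz_on_nonneg[OF lipschitz_grad_f]
      by (intro mult_right_mono mult_mono) (auto simp: m_def \<gamma>_def)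
    moreover have "par_c1 P + grid P 0 * mu P 0 * lip_f P + L_G P \<le> L * (2 - th_hi P)"
      using safe th_bounds by (simp add: pos_divide_le_eq)
    ultimately have "\<gamma> * m * lip_f P + L_G P + \<theta> - 2 * L + par_c1 P \<le> 0"
      using \<theta>(2) by (simp add: algebra_simps)
    then have "(\<gamma> * m * lip_f P + L_G P + \<theta> - 2 * L + par_c1 P) / (2 * m) * N \<le> 0"
      using m by (intro mult_nonpos_nonneg divide_nonpos_pos) (auto simp: N_def)
    moreover have "(\<gamma> * m * lip_f P + L_G P + \<theta> - 2 * L + par_c1 P) / (2 * m) * N
        = \<gamma> * (lip_f P / 2 * N) + (L_G P / m) / 2 * N + \<theta> / (2 * m) * N - L / m * N + par_c1 P / (2 * m) * N"
      using m by (simp add: field_simps)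
    ultimately show ?thesis
      by linarith
  qed
  have "\<gamma> * fun_f P v \<le> \<gamma> * (fun_f P w + grad (fun_f P) w \<bullet> (v - w) + lip_f P / 2 * N)"
    using f \<gamma> by (intro mult_left_mono) auto
  then have "\<gamma> * fun_f P v \<le> \<gamma> * fun_f P w + \<gamma> * (grad (fun_f P) w \<bullet> (v - w)) + \<gamma> * (lip_f P / 2 * N)"
    by (simp add: distrib_left)
  moreover have "phi P m (R_plus P S k L + zeta P (Suc k)) \<le> phi P m (R_val P v) + zeta P (Suc k)"
    using phi_add_le[OF m, of "zeta P (Suc k)" "R_plus P S k L"] zeta_pos[of "Suc k"]
      phi_mono[OF m accurate_R_inexact(1)[OF acc]] by (simp add: R_plus_def v_def)
  moreover have "phi P m (R_val P w) \<le> phi P m (R_it P S k) + zeta P k"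
    using phi_add_le[OF m, of "zeta P k" "R_it P S k"] zeta_pos[of k]
      phi_mono[OF m accurate_R_inexact(2)[OF it_z_accurate[of k]]] by (simp add: R_it_def w_def)
  ultimately have "\<gamma> * fun_f P v + phi P m (R_plus P S k L + zeta P (Suc k))
      \<le> \<gamma> * fun_f P w + phi P m (R_it P S k) - par_c1 P / (2 * m) * N
        + (m / (2 * \<theta>) * (E0 P k)\<^sup>2 + zeta P k + zeta P (Suc k))"
    using g proj err coeff by linarith
  then show ?thesis
    by (simp add: accepted_def tau_def w_def v_def m_def \<gamma>_def \<theta>_def N_def)
qed

lemma it_L_bounds: "0 < it_L S k" "it_L S k \<le> L_bar P"
proof -
  have c: "L_choice P S k"
    using run by (simp add: ivsp_run_def)
  have "0 < it_L S k \<and> it_L S k \<le> L_bar P"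
  proof (cases "strat P")
    case (Fixed L)
    then show ?thesis
      using c parameters L_safe_pos by (auto simp: L_choice_def L_bar_def ivsp_parameters_def)
  next
    case (Backtracking Lmin Lmax)
    then have Lmin: "0 < Lmin"
      using parameters by (simp add: ivsp_parameters_def)
    obtain j where L0: "Lmin \<le> it_L0 S k" "it_L0 S k \<le> Lmax" and j: "it_L S k = 2 ^ j * it_L0 S k"
      and acc: "\<And>i. i \<le> j \<Longrightarrow> accurate P (zeta P (Suc k))
                (it_zplus S k (2 ^ i * it_L0 S k)) (trial P S k (2 ^ i * it_L0 S k))"
      and rej: "\<And>i. i < j \<Longrightarrow> \<not> accepted P S k (2 ^ i * it_L0 S k)"
      using c Backtracking by (auto simp: L_choice_def)
    have "it_L S k \<le> max Lmax (2 * L_safe P)"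
    proof (cases j)
      case 0
      then show ?thesis
        using j L0 by simp
    next
      \<comment> \<open>After at least one doubling, the preceding value was rejected and so lies
        below \<open>L_safe P\<close>; the accepted value is its double.\<close>
      case (Suc i)
      then have "\<not> L_safe P \<le> 2 ^ i * it_L0 S k"
        using accepted_if_L_safe_le[OF _ acc[of i]] rej[of i] by auto
      then show ?thesis
        using Suc j by simp
    qed
    then show ?thesis
      using L0 Lmin j Backtracking by (simp add: L_bar_def)
  qed
  then show "0 < it_L S k" "it_L S k \<le> L_bar P"
    by simp_all
qed

lemma A0_pos: "0 < A0 P"
proof -
  have "0 < par_c2 P"
    using parameters by (simp add: ivsp_parameters_def)
  then have "0 < par_c2 P * (L_bar P + L_G P)"
    using L_G_nonneg it_L_bounds[of 0] by (intro mult_pos_pos) auto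
  then show ?thesis
    using M_f_nonneg by (simp add: A0_def)
qed

text \<open>At an update the derivative of the smoothing function exceeds 1/2 at the new iterate, so the
  optimality condition of the projection step exhibits a short element of a multiple of the cone
  bounded away from zero by the constraint qualification.\<close>

lemma eta_le_at_update:
  assumes upd: "penalty_update P S k"
  shows "eta P / 2 \<le> gam P S k * A0 P + E_rho P (mu P k) (zeta P k) + E_rho P (mu P k) (zeta P (Suc k))"
proof -
  define w v where "w = it_w S k" and "v = it_w S (Suc k)"
  define m \<gamma> L where "m = mu P k" and "\<gamma> = gam P S k" and "L = it_L S k"
  define p where "p = deriv (phi P m) (R_it P S (Suc k))"
  let ?F = "grad (fun_f P) w" and ?G = "gradG_it P S k" and ?B = "p *\<^sub>R gradR P v - G_grad P m v"
  have m: "0 < m" and \<gamma>: "0 < \<gamma>"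
    using mu_pos gam_pos by (auto simp: m_def \<gamma>_def)
  have L: "0 < L" "L \<le> L_bar P"
    using it_L_bounds by (auto simp: L_def)
  have vt: "v = trial P S k L"
    using run by (simp add: v_def L_def ivsp_run_def)
  have wf: "w \<in> feas P" and vf: "v \<in> feas P"
    using it_w_feas by (auto simp: w_def v_def)
  have R: "2 * a_phi P * m < R_it P S (Suc k)" and step: "norm (v - w) \<le> par_c2 P * m * \<gamma>"
    using upd by (auto simp: penalty_update_def m_def v_def w_def \<gamma>_def)
  have accv: "accurate P (zeta P (Suc k)) (it_z S (Suc k)) v"
    unfolding v_def by (rule it_z_accurate)
  have "0 < 2 * a_phi P * m"
    using a_phi_pos m by simp
  then have "0 \<le> R_val P v"
    using R accurate_R_inexact(1)[OF accv] unfolding R_it_def v_def by linarith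
  then have "v \<in> R_nonneg P"
    using vf by (simp add: R_nonneg_def)
  have p: "1 / 2 < p"
    unfolding p_def by (rule deriv_phi_gt_half[OF m R])
  define u where "u = - (\<gamma> *\<^sub>R ?F + ?G) - (L / m) *\<^sub>R (v - w)"
  have "u \<in> normal_cone (feas P) v"
    using trial_normal[OF L(1), of k] by (simp add: u_def vt \<gamma>_def m_def w_def)
  then have "(1 / p) *\<^sub>R u \<in> normal_cone (feas P) v"
    using p by (intro normal_cone_scaleR) auto
  from eta_le_norm[OF \<open>v \<in> R_nonneg P\<close> this]
  have "p * eta P \<le> p * norm (gradR P v + (1 / p) *\<^sub>R u)"
    using p by (intro mult_left_mono) auto
  also have "\<dots> = norm (p *\<^sub>R (gradR P v + (1 / p) *\<^sub>R u))"
    using p by simp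
  also have "p *\<^sub>R (gradR P v + (1 / p) *\<^sub>R u) = p *\<^sub>R gradR P v + u"
    using p by (simp add: scaleR_add_right)
  finally have "p * eta P \<le> norm (p *\<^sub>R gradR P v + u)" .
  \<comment> \<open>Telescoping: slope error at v, change of the exact penalty gradient from v to w,
    gradient error at w. Only the gradient of f and the step remain.\<close>
  also have "p *\<^sub>R gradR P v + u = ?B + ((G_grad P m v - G_grad P m w)
      + ((G_grad P m w - ?G) + (- (\<gamma> *\<^sub>R ?F) + - ((L / m) *\<^sub>R (v - w)))))"
    unfolding u_def by simp
  also have "norm \<dots> \<le> norm ?B + (norm (G_grad P m v - G_grad P m w)
      + (norm (G_grad P m w - ?G) + (norm (- (\<gamma> *\<^sub>R ?F)) + norm (- ((L / m) *\<^sub>R (v - w))))))"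
    by (intro norm_triangle_le add_left_mono) simp
  also have "norm ?B \<le> E_rho P m (zeta P (Suc k))"
  proof -
    have "?B = (deriv (phi P m) (R_inexact P (it_z S (Suc k)) v) - deriv (phi P m) (R_val P v)) *\<^sub>R gradR P v"
      by (simp add: p_def R_it_def G_grad_def v_def algebra_simps)
    moreover have "0 \<le> D_rho P (zeta P (Suc k))"
      using m_rho_pos zeta_pos[of "Suc k"] by (simp add: D_rho_def L_a_def)
    ultimately show ?thesis
      using deriv_phi_inexact_diff[OF m vf accv] by (simp add: E_rho_def)
  qed
  also have "norm (G_grad P m v - G_grad P m w) \<le> L_G P / m * norm (v - w)"
    using lipschitz_onD[OF lipschitz_G_grad vf wf, of m] m mu_le[of k] by (simp add: dist_norm m_def)
  also have "norm (G_grad P m w - ?G) \<le> E_rho P m (zeta P k)"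
    using gradG_it_error[of k] by (simp add: E0_def m_def w_def norm_minus_commute)
  also have "norm (- (\<gamma> *\<^sub>R ?F)) \<le> \<gamma> * M_f P"
    using norm_grad_f_le[OF wf] \<gamma> by (simp add: mult_left_mono)
  also have "norm (- ((L / m) *\<^sub>R (v - w))) \<le> L_bar P / m * norm (v - w)"
    using L m by (simp add: mult_right_mono divide_right_mono)
  finally have "p * eta P \<le> E_rho P m (zeta P (Suc k)) + (L_G P / m * norm (v - w)
      + (E_rho P m (zeta P k) + (\<gamma> * M_f P + L_bar P / m * norm (v - w))))"
    by simp
  \<comment> \<open>The step test carries the factor m \<gamma>, so 1/m cancels and every term
    except the errors is proportional to \<gamma>; the factor is \<open>A0\<close>.\<close>
  moreover have "(L_bar P + L_G P) / m * norm (v - w) \<le> (L_bar P + L_G P) / m * (par_c2 P * m * \<gamma>)"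
    using step L L_G_nonneg m by (intro mult_left_mono) auto
  moreover have "(L_bar P + L_G P) / m * (par_c2 P * m * \<gamma>) = \<gamma> * (par_c2 P * (L_bar P + L_G P))"
    using m by simp
  moreover have "(L_bar P + L_G P) / m * norm (v - w) = L_bar P / m * norm (v - w) + L_G P / m * norm (v - w)"
    by (simp add: add_divide_distrib distrib_right)
  moreover have "\<gamma> * A0 P = \<gamma> * M_f P + \<gamma> * (par_c2 P * (L_bar P + L_G P))"
    by (simp add: A0_def distrib_left)
  moreover have "eta P / 2 \<le> p * eta P"
  proof -
    have "0 \<le> eta P"
      unfolding eta_def using \<open>v \<in> R_nonneg P\<close> by (intro cINF_greatest) (auto simp: infdist_nonneg)
    then show ?thesis
      using mult_right_mono[of "1 / 2" p "eta P"] p by simp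
  qed
  ultimately show ?thesis
    unfolding m_def \<gamma>_def by linarith
qed

section \<open>Counting updates and bounding the penalty parameter\<close>

lemma no_update_if_R_negative:
  assumes "R_nonneg P = {}"
  shows "\<not> penalty_update P S k"
proof
  assume "penalty_update P S k"
  then have "2 * a_phi P * mu P k < R_it P S (Suc k)"
    by (simp add: penalty_update_def)
  moreover have "0 < 2 * a_phi P * mu P k"
    using a_phi_pos mu_pos[of k] by simp
  ultimately have "0 \<le> R_val P (it_w S (Suc k))"
    using accurate_R_inexact(1)[OF it_z_accurate[of "Suc k"]] by (simp add: R_it_def)
  then show False
    using assms it_w_feas[of "Suc k"] unfolding R_nonneg_def by blast
qed

lemma it_t_eq_card: "it_t S k = card {i. i < k \<and> penalty_update P S i}"
proof (induction k)
  case 0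
  then show ?case
    using run by (simp add: ivsp_run_def)
next
  case (Suc k)
  have "{i. i < Suc k \<and> penalty_update P S i}
      = (if penalty_update P S k then insert k {i. i < k \<and> penalty_update P S i}
         else {i. i < k \<and> penalty_update P S i})"
    by (auto simp: less_Suc_eq)
  then show ?case
    using run Suc by (simp add: ivsp_run_def)
qed

lemma it_t_le: "it_t S k \<le> k"
proof -
  have "card {i. i < k \<and> penalty_update P S i} \<le> card {..<k}"
    by (intro card_mono) auto
  then show ?thesis
    by (simp add: it_t_eq_card)
qed

text \<open>Infinitely many updates would drive the grid index past any T, and the grid tends to
  0.\<close>

lemma finite_updates_if_gam_bounded_below:
  assumes c: "0 < c" and gam: "\<And>k. c \<le> gam P S k"
  shows "finite {k. penalty_update P S k}"
proof (rule ccontr)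
  assume inf: "infinite {k. penalty_update P S k}"
  have "grid P \<longlonglongrightarrow> 0"
    using parameters by (simp add: ivsp_parameters_def)
  then have "\<forall>\<^sub>F t in sequentially. grid P t < c"
    by (rule order_tendstoD) (fact c)
  then obtain T where T: "grid P T < c"
    by (auto simp: eventually_sequentially)
  obtain F where F: "F \<subseteq> {k. penalty_update P S k}" "finite F" "card F = T"
    using infinite_arbitrarily_large[OF inf] by blast
  \<comment> \<open>An iteration beyond all T chosen updates; inserting 0 keeps \<open>Max\<close>
    meaningful when T = 0.\<close>
  define k where "k = Suc (Max (insert 0 F))"
  have "F \<subseteq> {i. i < k \<and> penalty_update P S i}"
    using F by (auto simp: k_def less_Suc_eq_le)
  then have "T \<le> it_t S k"
    using F card_mono[of "{i. i < k \<and> penalty_update P S i}" F] by (simp add: it_t_eq_card)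
  then have "gam P S k \<le> grid P T"
    unfolding gam_def by (rule grid_antimono)
  then show False
    using gam[of k] T by simp
qed

lemma gam_eventually_const:
  assumes "finite {k. penalty_update P S k}"
  shows "\<exists>K. \<forall>k\<ge>K. gam P S k = gam P S K"
proof -
  obtain K where K: "\<And>k. penalty_update P S k \<Longrightarrow> k < K"
    using finite_nat_bounded[OF assms] by auto
  have "{i. i < k \<and> penalty_update P S i} = {i. i < K \<and> penalty_update P S i}" if "K \<le> k" for k
    using K that by (blast intro: less_le_trans)
  then have "\<forall>k\<ge>K. gam P S k = gam P S K"
    unfolding gam_def it_t_eq_card by metis
  then show ?thesis
    by blast
qed

lemma E_rho_Suc_le: "E_rho P (mu P k) (zeta P (Suc k)) \<le> E_rho P (mu P k) (zeta P k)"
  unfolding E_rho_def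
  using D_rho_mono[OF zeta_Suc_le] zeta_Suc_le sm_b_nonneg bnd_R_pos mu_pos[of k]
  by (intro add_mono mult_left_mono) auto

lemma errors_eventually_small:
  assumes o: "zeta P \<in> o(mu P)" and c: "0 < c"
  shows "\<exists>k0. \<forall>k\<ge>k0. 2 * (E_rho P (mu P k) (zeta P k) + E_rho P (mu P k) (zeta P (Suc k)))
    + D_rho P (zeta P (Suc k)) \<le> c"
proof -
  have "zeta P \<longlonglongrightarrow> 0"
    using parameters by (simp add: ivsp_parameters_def)
  then have "(\<lambda>k. L_a P * sqrt (2 * zeta P k / m_rho P)) \<longlonglongrightarrow> L_a P * sqrt (2 * 0 / m_rho P)"
    using m_rho_pos by (intro tendsto_intros) auto
  then have D: "(\<lambda>k. D_rho P (zeta P k)) \<longlonglongrightarrow> 0"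
    by (simp add: D_rho_def)
  have "(\<lambda>k. sm_b P * bnd_R P * (zeta P k / mu P k)) \<longlonglongrightarrow> sm_b P * bnd_R P * 0"
    by (rule tendsto_mult_left[OF smalloD_tendsto[OF o]])
  \<comment> \<open>Since \<open>zeta\<close> is nonincreasing, 4E + D at index k dominates the
    expression with both indices. Here D vanishes with \<open>zeta\<close>, and the slope error by
    the little-o assumption.\<close>
  then have "(\<lambda>k. 4 * (D_rho P (zeta P k) + sm_b P * bnd_R P * (zeta P k / mu P k)) + D_rho P (zeta P k))
      \<longlonglongrightarrow> 4 * (0 + sm_b P * bnd_R P * 0) + 0"
    by (rule tendsto_add[OF tendsto_mult_left[OF tendsto_add[OF D]] D])
  then have "(\<lambda>k. 4 * E_rho P (mu P k) (zeta P k) + D_rho P (zeta P k)) \<longlonglongrightarrow> 0"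
    by (simp add: E_rho_def field_simps)
  then have "\<forall>\<^sub>F k in sequentially. 4 * E_rho P (mu P k) (zeta P k) + D_rho P (zeta P k) < c"
    by (rule order_tendstoD) (fact c)
  then obtain k0 where k0: "\<And>k. k \<ge> k0 \<Longrightarrow> 4 * E_rho P (mu P k) (zeta P k) + D_rho P (zeta P k) < c"
    by (auto simp: eventually_sequentially)
  have "2 * (E_rho P (mu P k) (zeta P k) + E_rho P (mu P k) (zeta P (Suc k)))
    + D_rho P (zeta P (Suc k)) \<le> c" if "k \<ge> k0" for k
    using k0[OF that] add_mono[OF mult_left_mono[OF E_rho_Suc_le[of k], of 2] D_rho_mono[OF zeta_Suc_le[of k]]]
    by (simp add: distrib_left)
  then show ?thesis
    by blast
qed

text \<open>Induction over the iterations. Up to k0 the grid index is at most k0. At a later update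
  both errors together are at most eta/4, so \<gamma> is at least eta / (4 A0) before the update and
  loses at most the factor M in it; otherwise \<gamma> does not change.\<close>

lemma gam_lower_bound:
  assumes small: "\<And>k. k \<ge> k0 \<Longrightarrow> 2 * (E_rho P (mu P k) (zeta P k) + E_rho P (mu P k) (zeta P (Suc k)))
      + D_rho P (zeta P (Suc k)) \<le> eta P / 2"
    and M: "M > 1" "\<And>t. grid P t \<le> M * grid P (Suc t)"
  shows "min (grid P k0) (eta P / (4 * M * A0 P)) \<le> gam P S k"
proof (induction k)
  case 0
  then show ?case
    using it_t_le[of 0] grid_antimono[of 0 k0] by (simp add: gam_def min.coboundedI1)
next
  case (Suc k)
  show ?case
  proof (cases "k0 \<le> k \<and> penalty_update P S k")
    case True
    have "0 \<le> D_rho P (zeta P (Suc k))"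
      using m_rho_pos zeta_pos[of "Suc k"] by (simp add: D_rho_def L_a_def)
    then have "eta P / 4 \<le> gam P S k * A0 P"
      using eta_le_at_update[of k] small[of k] True by simp
    also have "\<dots> \<le> (M * gam P S (Suc k)) * A0 P"
    proof -
      have "it_t S (Suc k) = Suc (it_t S k)"
        using run True by (simp add: ivsp_run_def)
      then show ?thesis
        using M(2)[of "it_t S k"] A0_pos by (intro mult_right_mono) (auto simp: gam_def)
    qed
    finally have "eta P / (4 * M * A0 P) \<le> gam P S (Suc k)"
      using A0_pos M(1) by (simp add: field_simps)
    then show ?thesis
      by (simp add: min.coboundedI2)
  next
    case False
    show ?thesis
    proof (cases "k0 \<le> k")
      case True
      then have "it_t S (Suc k) = it_t S k"
        using False run by (simp add: ivsp_run_def)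
      then show ?thesis
        using Suc by (simp add: gam_def)
    next
      case False
      then have "it_t S (Suc k) \<le> k0"
        using it_t_le[of "Suc k"] by linarith
      then show ?thesis
        unfolding gam_def by (intro min.coboundedI1 grid_antimono)
    qed
  qed
qed

end

theorem lemma5:
  fixes P :: "('n::finite, 'm::finite) ivsp" and S :: "('n, 'm) trace" and M_gamma :: real
  assumes setting: "bilevel_setting P"
    and smoothing: "smoothing_family P"
    and parameters: "ivsp_parameters P"
    and run: "ivsp_run P S"
    and cq: "ENNAMCQ P"
    and zeta_mu: "zeta P \<in> o(mu P)"
    and M_gamma: "M_gamma > 1" "\<And>t. grid P t \<le> M_gamma * grid P (Suc t)"
  shows "(R_nonneg P = {} \<longrightarrow>
            (\<forall>k. \<not> penalty_update P S k) \<and> (\<forall>k. gam P S k = grid P 0)) \<and>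
         (R_nonneg P \<noteq> {} \<longrightarrow>
            (\<exists>w\<in>R_nonneg P. eta P = infdist 0 (gradR_cone P w)) \<and> eta P > 0 \<and>
            (\<exists>k0.
               (\<forall>k\<ge>k0.
                  2 * (E_rho P (mu P k) (zeta P k) + E_rho P (mu P k) (zeta P (Suc k)))
                    + D_rho P (zeta P (Suc k)) \<le> eta P / 2) \<and>
               min (grid P k0) (eta P / (4 * M_gamma * A0 P)) > 0 \<and>
               (\<forall>k. gam P S k \<ge> min (grid P k0) (eta P / (4 * M_gamma * A0 P))))) \<and>
         finite {k. penalty_update P S k} \<and>
         (\<exists>K. \<forall>k\<ge>K. gam P S k = gam P S K)"
proof -
  interpret ivsp_iteration P S
    by unfold_locales (fact setting smoothing parameters run)+
  show ?thesis
  proof (cases "R_nonneg P = {}")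
    case True
    then have no: "\<not> penalty_update P S k" for k
      by (rule no_update_if_R_negative)
    then have fin: "finite {k. penalty_update P S k}"
      by simp
    have "gam P S k = grid P 0" for k
      by (simp add: gam_def it_t_eq_card no)
    then show ?thesis
      using True no fin gam_eventually_const[OF fin] by blast
  next
    case False
    note eta = eta_attained[OF False cq]
    obtain k0 where k0: "\<And>k. k \<ge> k0 \<Longrightarrow> 2 * (E_rho P (mu P k) (zeta P k) + E_rho P (mu P k) (zeta P (Suc k)))
        + D_rho P (zeta P (Suc k)) \<le> eta P / 2"
      using errors_eventually_small[OF zeta_mu, of "eta P / 2"] eta(2) by auto
    note lower = gam_lower_bound[OF k0 M_gamma]
    have "0 < grid P k0"
      using parameters by (simp add: ivsp_parameters_def)
    then have pos: "0 < min (grid P k0) (eta P / (4 * M_gamma * A0 P))"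
      using eta(2) A0_pos M_gamma(1) by simp
    note fin = finite_updates_if_gam_bounded_below[OF pos lower]
    show ?thesis
      using False eta k0 pos lower fin gam_eventually_const[OF fin] by blast
  qed
qed

end
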